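(* Fix $\varepsilon>0$ and let $\lambda:(0,\infty)\to(0,\infty)$ satisfy $\lambda(t)\downarrow 0$ and $t+\ln(\lambda(t)\varepsilon^2)\uparrow\infty$ as $t\uparrow\infty$. Then for every $\Delta\in\mathbb{R}$ and all measurable sets $A_0,A_1\subset\mathbb{R}_+^U$, $$\lim_{t\uparrow\infty}\widehat P_{\lambda(t),t}\Big(e_\emptyset\le \Delta+t+\ln(\lambda(t)\varepsilon^2),\ (e_{0w})_{w\in U}\in A_0,\ (e_{1w})_{w\in U}\in A_1\Big)=Q_{\infty,-\infty}\Big(S\le \Delta,\ (e_{0w})_{w\in U}\in A_0,\ (e_{1w})_{w\in U}\in A_1\Big),$$ where $Q_{\infty,-\infty}$ is the law of the limiting model and $S$ its recentred first branching time.
   Context: Let $U=\bigcup_{k\ge 0}\{0,1\}^k$ be the vertex set of the infinite rooted binary tree ($\emptyset$ is the root; $0w$, $1w$, $w\in U$, are the vertices of the two subtrees rooted at the children $0$ and $1$ of the root). Under $\mathbb{P}$, with expectation $\mathbb{E}$, the waiting times $(e_w)_{w\in U}$ are i.i.d. standard exponential random variables; $e_w$ is the time from the birth of $w$ to its branching (into its two children $w0$, $w1$). The root is born at time $0$, and each other vertex is born when its parent branches. This is the genealogical tree of binary branching Brownian motion. $n(h)$ denotes the number of vertices alive at time $h$. $\mathbb{R}_+^U$ carries the product $\sigma$-algebra. Set $\sigma(\lambda,\varepsilon)=\operatorname{sech}(\varepsilon\sqrt{2\lambda})$, $v_\sigma(h)=\mathbb{E}[\sigma^{n(h)-1}]$,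 and $\widehat P_{\lambda,h}(A)=\mathbb{E}[\mathbf 1_A\,\sigma(\lambda,\varepsilon)^{n(h)-1}]/v_{\sigma(\lambda,\varepsilon)}(h)$. Limiting model. For $T\in\mathbb{R}$ let $q_{\infty,T}$ be the probability law on $[0,\infty)$ with distribution function $$q_{\infty,T}(e\le x)=\frac{1-e^{-x}}{e^{-x-T}+1},\qquad x\ge 0.$$ Under $Q_{\infty,-\infty}$ there is a real random variable $S$ (the branching time of the root, recentred, arising from starting the model at time $t_0\to-\infty$) with distribution function $Q_{\infty,-\infty}(S\le\Delta)=1/(1+e^{-\Delta})$, $\Delta\in\mathbb{R}$, and waiting times $(e_w)_{w\in U\setminus\{\emptyset\}}$ defined recursively as follows. Put $T_\emptyset=S$. Conditionally on $S$ and all waiting times of generations $1,\dots,k-1$, the waiting times $e_w$ of the vertices $w$ of generation $k$ are independent, $e_w$ having law $q_{\infty,T_{p(w)}}$, where $p(w)$ is the parent of $w$; then $T_w=T_{p(w)}+e_w$. *)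

theory Defs
  imports "HOL-Probability.Probability"
begin

text \<open>
  Vertices of the infinite rooted binary tree are finite words over \<open>bool\<close>
  (\<open>False\<close> for 0, \<open>True\<close> for 1), read from the root: the children of \<open>w\<close> are
  \<open>w @ [b]\<close>, the parent of \<open>w \<noteq> []\<close> is \<open>butlast w\<close>, and \<open>b # w\<close> is the copy of \<open>w\<close> in
  the subtree rooted at the child \<open>b\<close> of the root.
\<close>

type_synonym vertex = "bool list"

definition waiting_space :: "(vertex \<Rightarrow> real) measure" where
  "waiting_space = (\<Pi>\<^sub>M w\<in>UNIV. restrict_space borel {0..})"

subsection \<open>The binary branching tree\<close>

definition branching_tree :: "'a measure \<Rightarrow> (vertex \<Rightarrow> 'a \<Rightarrow> real) \<Rightarrow> bool" where
  "branching_tree M e \<longleftrightarrow> prob_space M \<and>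
     prob_space.indep_vars M (\<lambda>_. borel) e UNIV \<and>
     (\<forall>w. distributed M lborel (e w) (exponential_density 1))"

text \<open>Here \<open>x\<close> is a realisation of the waiting times.\<close>

fun birth_time :: "(vertex \<Rightarrow> real) \<Rightarrow> vertex \<Rightarrow> real" where
  "birth_time x w = (if w = [] then 0 else birth_time x (butlast w) + x (butlast w))"

declare birth_time.simps [simp del]

definition alive :: "(vertex \<Rightarrow> real) \<Rightarrow> real \<Rightarrow> vertex set" where
  "alive x h = {w. birth_time x w \<le> h \<and> h < birth_time x w + x w}"

text \<open>
  For \<open>h \<ge> 0\<close>, almost surely \<open>alive x h\<close> is finite and nonempty; so the
  junk values \<open>card A = 0\<close> for infinite \<open>A\<close> and \<open>0 - 1 = 0\<close> only occur on a null set.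
\<close>

definition num_alive :: "(vertex \<Rightarrow> real) \<Rightarrow> real \<Rightarrow> nat" where
  "num_alive x h = card (alive x h)"

definition sech :: "real \<Rightarrow> real" where
  "sech x = 1 / cosh x"

definition sig :: "real \<Rightarrow> real \<Rightarrow> real" where
  "sig l \<epsilon> = sech (\<epsilon> * sqrt (2 * l))"

definition v_sigma :: "'a measure \<Rightarrow> (vertex \<Rightarrow> 'a \<Rightarrow> real) \<Rightarrow> real \<Rightarrow> real \<Rightarrow> real" where
  "v_sigma M e s h = (\<integral>\<omega>. s ^ (num_alive (\<lambda>w. e w \<omega>) h - 1) \<partial>M)"

definition P_hat ::
  "'a measure \<Rightarrow> (vertex \<Rightarrow> 'a \<Rightarrow> real) \<Rightarrow> real \<Rightarrow> real \<Rightarrow> real \<Rightarrow> 'a set \<Rightarrow> real" where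
  "P_hat M e \<epsilon> l h A =
     (\<integral>\<omega>. indicator A \<omega> * sig l \<epsilon> ^ (num_alive (\<lambda>w. e w \<omega>) h - 1) \<partial>M) / v_sigma M e (sig l \<epsilon>) h"

subsection \<open>The limiting model\<close>

definition q_inf_cdf :: "real \<Rightarrow> real \<Rightarrow> real" where
  "q_inf_cdf T x = (if x < 0 then 0 else (1 - exp (- x)) / (exp (- x - T) + 1))"

definition q_inf :: "real \<Rightarrow> real measure" where
  "q_inf T = interval_measure (q_inf_cdf T)"

fun recentred_time :: "real \<Rightarrow> (vertex \<Rightarrow> real) \<Rightarrow> vertex \<Rightarrow> real" where
  "recentred_time s x w = (if w = [] then s else recentred_time s x (butlast w) + x w)"

declare recentred_time.simps [simp del]

text \<open>The \<open>\<sigma>\<close>-algebra generated by \<open>S\<close> and the waiting times of generations \<open>1, \<dots>, k - 1\<close>.\<close>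

definition past ::
  "'a measure \<Rightarrow> ('a \<Rightarrow> real) \<Rightarrow> (vertex \<Rightarrow> 'a \<Rightarrow> real) \<Rightarrow> nat \<Rightarrow> 'a measure" where
  "past N S e k = vimage_algebra (space N)
     (\<lambda>\<omega>. (S \<omega>, \<lambda>w\<in>{w. 1 \<le> length w \<and> length w < k}. e w \<omega>))
     (borel \<Otimes>\<^sub>M (\<Pi>\<^sub>M w\<in>{w. 1 \<le> length w \<and> length w < k}. borel))"

text \<open>
  \<open>limiting_model N S e\<close>: the probability measure \<open>N\<close>, with the recentred branching time \<open>S\<close>
  of the root and the waiting times \<open>e w\<close> of the vertices \<open>w \<noteq> []\<close>, is a realisation of
  \<open>Q\<^bsub>\<infinity>,-\<infinity>\<^esub>\<close>. The value \<open>e []\<close> is irrelevant.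
\<close>

definition limiting_model ::
  "'a measure \<Rightarrow> ('a \<Rightarrow> real) \<Rightarrow> (vertex \<Rightarrow> 'a \<Rightarrow> real) \<Rightarrow> bool" where
  "limiting_model N S e \<longleftrightarrow> prob_space N \<and>
     S \<in> borel_measurable N \<and> (\<forall>w. w \<noteq> [] \<longrightarrow> e w \<in> borel_measurable N) \<and>
     (\<forall>\<Delta>. measure N {\<omega> \<in> space N. S \<omega> \<le> \<Delta>} = 1 / (1 + exp (- \<Delta>))) \<and>
     (\<forall>k\<ge>1. \<forall>B. (\<forall>w. B w \<in> sets borel) \<longrightarrow>
        (AE \<omega> in N.
           real_cond_exp N (past N S e k)
             (indicator {\<omega> \<in> space N. \<forall>w. length w = k \<longrightarrow> e w \<omega> \<in> B w}) \<omega>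
           = (\<Prod>w | length w = k.
                measure (q_inf (recentred_time (S \<omega>) (\<lambda>u. e u \<omega>) (butlast w))) (B w))))"

subsection \<open>Sanity checks\<close>

text \<open>
  \<open>q_inf T\<close> is the probability law with distribution function \<open>q_inf_cdf T\<close>, and both models
  exist. The limiting model is realised by applying the quantile functions of the laws \<open>q_inf T\<close>
  to independent uniform random variables.
\<close>

lemma branching_tree_exists:
  "branching_tree (\<Pi>\<^sub>M w\<in>UNIV. density lborel (exponential_density 1)) (\<lambda>w x. x w)"
proof -
  let ?E = "density lborel (exponential_density 1) :: real measure"
  interpret E: prob_space ?E by (rule prob_space_exponential_density) simp
  interpret P: product_prob_space "\<lambda>_::vertex. ?E" UNIV by standard
  have comp: "distr (\<Pi>\<^sub>M w\<in>UNIV. ?E) borel (\<lambda>x. x w) = ?E" for w :: vertex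
  proof -
    have "distr (\<Pi>\<^sub>M w\<in>UNIV. ?E) borel (\<lambda>x. x w) = distr (\<Pi>\<^sub>M w\<in>UNIV. ?E) ?E (\<lambda>x. x w)"
      by (rule distr_cong) auto
    also have "\<dots> = ?E" by (rule P.PiM_component) simp
    finally show ?thesis .
  qed
  have m: "(\<lambda>x. x w) \<in> borel_measurable (\<Pi>\<^sub>M w\<in>UNIV. ?E)" for w :: vertex
  proof -
    have "(\<lambda>x. x w) \<in> measurable (\<Pi>\<^sub>M w\<in>UNIV. ?E) ?E"
      by (rule measurable_component_singleton) simp
    then show ?thesis
      using measurable_cong_sets[OF refl, of ?E borel] by auto
  qed
  have "distr (\<Pi>\<^sub>M w\<in>UNIV. ?E) (\<Pi>\<^sub>M w\<in>(UNIV :: vertex set). borel) (\<lambda>x. x) = (\<Pi>\<^sub>M w\<in>UNIV. ?E)"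
    by (rule distr_id2) (intro sets_PiM_cong, auto)
  then have "P.indep_vars (\<lambda>_. borel) (\<lambda>w x. x w) UNIV"
    by (subst P.indep_vars_iff_distr_eq_PiM) (auto simp: comp m restrict_UNIV)
  moreover have "distr (\<Pi>\<^sub>M w\<in>UNIV. ?E) lborel (\<lambda>x. x w) = ?E" for w :: vertex
  proof -
    have "distr (\<Pi>\<^sub>M w\<in>UNIV. ?E) lborel (\<lambda>x. x w) = distr (\<Pi>\<^sub>M w\<in>UNIV. ?E) borel (\<lambda>x. x w)"
      by (rule distr_cong) auto
    then show ?thesis using comp by simp
  qed
  ultimately show ?thesis
    unfolding branching_tree_def distributed_def using m P.prob_space_axioms by auto
qed

lemma q_inf_cdf_mono: "x \<le> y \<Longrightarrow> q_inf_cdf T x \<le> q_inf_cdf T y"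
  unfolding q_inf_cdf_def by (auto intro!: frac_le add_pos_pos add_nonneg_pos)

lemma q_inf_cdf_eq:
  "q_inf_cdf T = (\<lambda>x. (1 - exp (- max 0 x)) / (exp (- max 0 x - T) + 1))"
  by (auto simp: q_inf_cdf_def fun_eq_iff max_def)

lemma continuous_q_inf_cdf: "isCont (q_inf_cdf T) x"
proof -
  have "exp (- max 0 x - T) + 1 \<noteq> 0"
    by (smt (verit) exp_gt_zero)
  then show ?thesis
    unfolding q_inf_cdf_eq by (intro continuous_intros) auto
qed

lemma q_inf_cdf_at_bot: "(q_inf_cdf T \<longlongrightarrow> 0) at_bot"
  by (rule tendsto_eventually)
     (auto simp: q_inf_cdf_def eventually_at_bot_linorder intro!: exI[of _ "-1"])

lemma q_inf_cdf_at_top: "(q_inf_cdf T \<longlongrightarrow> 1) at_top"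
proof -
  have "((\<lambda>x::real. (1 - exp (- x)) / (exp (- x) * exp (-T) + 1)) \<longlongrightarrow> (1 - 0) / (0 * exp (-T) + 1)) at_top"
    by (intro tendsto_intros filterlim_compose[OF exp_at_bot filterlim_uminus_at_bot_at_top]) auto
  then have "((\<lambda>x::real. (1 - exp (- x)) / (exp (- x - T) + 1)) \<longlongrightarrow> 1) at_top"
    by (simp add: exp_diff exp_minus divide_inverse)
  then show ?thesis
    by (rule Lim_transform_eventually)
       (auto simp: q_inf_cdf_def eventually_at_top_linorder intro!: exI[of _ 0])
qed

lemma real_distribution_q_inf: "real_distribution (q_inf T)"
  unfolding q_inf_def
  by (intro real_distribution_interval_measure q_inf_cdf_mono q_inf_cdf_at_bot q_inf_cdf_at_top
      continuous_within_subset[OF continuous_q_inf_cdf]) auto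

lemma cdf_q_inf: "cdf (q_inf T) = q_inf_cdf T"
  unfolding q_inf_def
  by (intro cdf_interval_measure q_inf_cdf_mono q_inf_cdf_at_bot 
      continuous_within_subset[OF continuous_q_inf_cdf]) auto

definition unif :: "real measure" where "unif = uniform_measure lborel {0<..<1}"

definition q_quantile :: "real \<Rightarrow> real \<Rightarrow> real" where
  "q_quantile T u = ln ((1 + u * exp (- T)) / (1 - u))"

lemma sets_unif [measurable_cong, simp]: "sets unif = sets borel"
  and space_unif [simp]: "space unif = UNIV"
  by (auto simp: unif_def)

lemma prob_space_unif: "prob_space unif"
  unfolding unif_def by (rule prob_space_uniform_measure) auto

lemma measurable_q_quantile [measurable]:
  assumes [measurable]: "f \<in> borel_measurable M" "g \<in> borel_measurable M"
  shows "(\<lambda>x. q_quantile (f x) (g x)) \<in> borel_measurable M"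
  unfolding q_quantile_def by measurable

lemma measure_unif_Iic:
  assumes "A \<in> sets borel" and "\<And>u. 0 < u \<Longrightarrow> u < 1 \<Longrightarrow> u \<in> A \<longleftrightarrow> u \<le> c" and "0 \<le> c" "c \<le> 1"
  shows "measure unif A = c"
proof -
  have eq: "{0<..<1} \<inter> A = (if c = 1 then {0<..<1} else {0<..c})"
    using assms by auto
  have "emeasure unif A = ennreal c"
    unfolding unif_def using assms by (subst emeasure_uniform_measure) (auto simp: eq divide_ennreal_def)
  then show ?thesis
    using assms by (simp add: measure_def)
qed

lemma distr_q_quantile: "distr unif borel (q_quantile T) = q_inf T"
proof (rule cdf_unique)
  interpret unif: prob_space unif by (rule prob_space_unif)
  have m: "q_quantile T \<in> borel_measurable unif" by measurable
  show "real_distribution (distr unif borel (q_quantile T))"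
    by (rule unif.real_distribution_distr) (rule m)
  show "real_distribution (q_inf T)" by (rule real_distribution_q_inf)
  show "cdf (distr unif borel (q_quantile T)) = cdf (q_inf T)"
  proof
    fix x :: real
    have "measure unif {u. q_quantile T u \<le> x} = q_inf_cdf T x"
    proof (rule measure_unif_Iic)
      show "{u. q_quantile T u \<le> x} \<in> sets borel" by measurable
      show "0 \<le> q_inf_cdf T x" "q_inf_cdf T x \<le> 1"
        by (auto simp: q_inf_cdf_def divide_simps add_pos_pos intro!: add_nonneg_nonneg)
           (smt (verit) exp_gt_zero)+
      fix u :: real assume u: "0 < u" "u < 1"
      have a: "exp (-T) > 0" by simp
      have p: "1 + u * exp (-T) > 0" using u by (simp add: add_pos_pos)
      have "q_quantile T u \<le> x \<longleftrightarrow> (1 + u * exp (- T)) / (1 - u) \<le> exp x"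
        unfolding q_quantile_def using u p by (subst ln_le_cancel_iff[of _ "exp x", symmetric]) auto
      also have "\<dots> \<longleftrightarrow> u * (exp (- T) + exp x) \<le> exp x - 1"
        using u by (auto simp: divide_simps algebra_simps)
      finally have *: "q_quantile T u \<le> x \<longleftrightarrow> u * (exp (- T) + exp x) \<le> exp x - 1" .
      show "u \<in> {u. q_quantile T u \<le> x} \<longleftrightarrow> u \<le> q_inf_cdf T x"
      proof (cases "x < 0")
        case True
        then have "exp x - 1 < 0" "u * (exp (- T) + exp x) > 0"
          using u by (auto intro!: mult_pos_pos add_pos_pos)
        then have "\<not> q_quantile T u \<le> x" unfolding * by linarith
        with True u show ?thesis by (simp add: q_inf_cdf_def)
      next
        case False
        have d: "exp (- T) + exp x > 0" by (simp add: add_pos_pos)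
        have "q_inf_cdf T x = (exp x - 1) / (exp (- T) + exp x)"
        proof -
          have "1 - exp (- x) = (exp x - 1) / exp x"
            by (simp add: exp_minus field_simps)
          moreover have "exp (- x - T) + 1 = (exp (- T) + exp x) / exp x"
            by (simp add: exp_diff exp_minus field_simps)
          ultimately show ?thesis using False by (simp add: q_inf_cdf_def)
        qed
        then show ?thesis using d by (simp add: * pos_le_divide_eq)
      qed
    qed
    then show "cdf (distr unif borel (q_quantile T)) x = cdf (q_inf T) x"
      unfolding cdf_q_inf by (simp add: cdf_def measure_distr[OF m] vimage_def)
  qed
qed

lemma measure_q_inf:
  assumes [measurable]: "B \<in> sets borel"
  shows "measure (q_inf T) B = (\<integral>u. indicator B (q_quantile T u) \<partial>unif)"
proof -
  have "measure (q_inf T) B = (\<integral>x. indicator B x \<partial>distr unif borel (q_quantile T))"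
    by (simp add: distr_q_quantile q_inf_def)
  also have "\<dots> = (\<integral>u. indicator B (q_quantile T u) \<partial>unif)"
    by (subst integral_distr) auto
  finally show ?thesis .
qed

fun quantile_time :: "(vertex \<Rightarrow> real) \<Rightarrow> vertex \<Rightarrow> real" where
  "quantile_time u w = (if w = [] then ln (u [] / (1 - u []))
     else quantile_time u (butlast w) + q_quantile (quantile_time u (butlast w)) (u w))"

declare quantile_time.simps [simp del]

lemma quantile_time_cong: "(\<And>w'. length w' \<le> length w \<Longrightarrow> u w' = u' w') \<Longrightarrow> quantile_time u w = quantile_time u' w"
  by (induction w rule: length_induct) (auto simp: quantile_time.simps[of u] quantile_time.simps[of u'])

lemma recentred_time_quantile_time:
  "recentred_time (quantile_time u []) (\<lambda>w. q_quantile (quantile_time u (butlast w)) (u w)) w = quantile_time u w"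
  by (induction w rule: length_induct) (auto simp: quantile_time.simps[of u] recentred_time.simps)

lemma measurable_quantile_time:
  assumes "\<And>w'. length w' \<le> length w \<Longrightarrow> (\<lambda>x. f x w') \<in> borel_measurable M"
  shows "(\<lambda>x. quantile_time (f x) w) \<in> borel_measurable M"
  using assms
proof (induction w rule: length_induct)
  case (1 w)
  show ?case
  proof (cases "w = []")
    case True
    then show ?thesis using 1(2)[of "[]"] by (simp add: quantile_time.simps)
  next
    case False
    have [measurable]: "(\<lambda>x. quantile_time (f x) (butlast w)) \<in> borel_measurable M"
      using 1 False by auto
    have [measurable]: "(\<lambda>x. f x w) \<in> borel_measurable M" using 1(2)[of w] by simp
    show ?thesis using False by (subst quantile_time.simps) simp
  qed
qed

lemma finite_words: "finite {w :: bool list. length w = n}"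
  using finite_lists_length_eq[of "UNIV :: bool set" n] by simp

lemma finite_words_less: "finite {w :: bool list. length w < n}"
proof -
  have "{w :: bool list. length w < n} = (\<Union>i<n. {w. length w = i})" by auto
  then show ?thesis by (simp add: finite_words)
qed

lemma measurable_recentred_time:
  assumes "s \<in> borel_measurable M"
    and "\<And>w'. w' \<noteq> [] \<Longrightarrow> length w' \<le> length w \<Longrightarrow> (\<lambda>x. f x w') \<in> borel_measurable M"
  shows "(\<lambda>x. recentred_time (s x) (f x) w) \<in> borel_measurable M"
  using assms
proof (induction w rule: length_induct)
  case (1 w)
  show ?case
  proof (cases "w = []")
    case True
    then show ?thesis using 1 by (simp add: recentred_time.simps)
  next
    case False
    have [measurable]: "(\<lambda>x. recentred_time (s x) (f x) (butlast w)) \<in> borel_measurable M"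
      using 1 False by auto
    have [measurable]: "(\<lambda>x. f x w) \<in> borel_measurable M" using 1(3)[of w] False by simp
    show ?thesis using False by (subst recentred_time.simps) simp
  qed
qed

lemma limiting_model_exists:
  "limiting_model (\<Pi>\<^sub>M w\<in>UNIV. unif) (\<lambda>u. quantile_time u []) (\<lambda>w u. q_quantile (quantile_time u (butlast w)) (u w))"
  (is "limiting_model ?N ?S ?e")
proof -
  interpret unif: prob_space unif by (rule prob_space_unif)
  interpret PP: product_prob_space "\<lambda>_::vertex. unif" UNIV by standard
  have R_meas [measurable]: "(\<lambda>u. quantile_time u w) \<in> borel_measurable ?N" for w
    by (rule measurable_quantile_time) auto
  have e_meas [measurable]: "?e w \<in> borel_measurable ?N" for w
    by measurable
  have S_law: "measure ?N {u \<in> space ?N. ?S u \<le> d} = 1 / (1 + exp (- d))" for d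
  proof -
    have "measure ?N {u \<in> space ?N. ?S u \<le> d}
        = measure (distr ?N unif (\<lambda>u. u [])) {a. ln (a / (1 - a)) \<le> d}"
      by (subst measure_distr) (auto simp: quantile_time.simps vimage_def space_PiM intro!: arg_cong[where f="measure ?N"])
    also have "distr ?N unif (\<lambda>u. u []) = unif"
      by (rule PP.PiM_component) simp
    also have "measure unif {a. ln (a / (1 - a)) \<le> d} = 1 / (1 + exp (- d))"
    proof (rule measure_unif_Iic)
      fix a :: real assume a: "0 < a" "a < 1"
      have "ln (a / (1 - a)) \<le> d \<longleftrightarrow> a / (1 - a) \<le> exp d"
        using a by (subst ln_le_cancel_iff[of _ "exp d", symmetric]) auto
      also have "\<dots> \<longleftrightarrow> a * (1 + exp d) \<le> exp d"
        using a by (auto simp: divide_simps algebra_simps)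
      also have "\<dots> \<longleftrightarrow> a \<le> exp d / (1 + exp d)"
        by (subst pos_le_divide_eq) (auto simp: add_pos_pos)
      also have "exp d / (1 + exp d) = 1 / (1 + exp (- d))"
        by (simp add: exp_minus field_simps add_pos_pos)
      finally show "a \<in> {a. ln (a / (1 - a)) \<le> d} \<longleftrightarrow> a \<le> 1 / (1 + exp (- d))" by simp
    qed (auto simp: divide_simps add_pos_pos)
    finally show ?thesis .
  qed
  have cond: "AE u in ?N. real_cond_exp ?N (past ?N ?S ?e k)
         (indicator {u \<in> space ?N. \<forall>w. length w = k \<longrightarrow> ?e w u \<in> B w}) u
       = (\<Prod>w | length w = k.
            measure (q_inf (recentred_time (?S u) (\<lambda>v. ?e v u) (butlast w))) (B w))"
    if k: "k \<ge> 1" and B [measurable]: "\<And>w. B w \<in> sets borel" for k B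
  proof -
    define J :: "vertex set" where "J = {w. length w < k}"
    define K :: "vertex set" where "K = {w. length w = k}"
    define G :: "vertex set" where "G = {w. 1 \<le> length w \<and> length w < k}"
    have JK: "J \<inter> K = {}" "finite J" "finite K" "J \<union> K = {w. length w \<le> k}"
      by (auto simp: J_def K_def finite_words finite_words_less)
    have fG: "finite G" by (rule finite_subset[OF _ JK(2)]) (auto simp: G_def J_def)
    have bl: "length (butlast w) < k" if "w \<in> K" for w
      using that k by (auto simp: K_def)
    let ?X = "\<lambda>u. (?S u, \<lambda>w\<in>G. ?e w u)"
    let ?C = "borel \<Otimes>\<^sub>M (\<Pi>\<^sub>M w\<in>G. borel) :: (real \<times> (vertex \<Rightarrow> real)) measure"
    let ?F = "past ?N ?S ?e k"
    have F_eq: "?F = vimage_algebra (space ?N) ?X ?C"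
      by (simp add: past_def G_def)
    have X_sp: "?X \<in> space ?N \<rightarrow> space ?C" by (auto simp: space_pair_measure space_PiM)
    have X_meas [measurable]: "?X \<in> measurable ?N ?C" by measurable
    have subalg: "subalgebra ?N ?F"
      unfolding subalgebra_def F_eq sets_vimage_algebra2[OF X_sp]
      using measurable_sets[OF X_meas] by auto
    interpret F: finite_measure_subalgebra ?N ?F
      by standard (rule subalg)
    have X_F: "?X \<in> measurable ?F ?C"
      unfolding F_eq by (rule measurable_vimage_algebra1[OF X_sp])
    have S_F: "?S \<in> borel_measurable ?F"
      using measurable_compose[OF X_F measurable_fst] by simp
    have e_F: "?e w \<in> borel_measurable ?F" if "w \<in> G" for w
      using measurable_compose[OF measurable_compose[OF X_F measurable_snd]
          measurable_component_singleton[OF that, of "\<lambda>_. borel"]] that by simp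
    have R_F: "(\<lambda>u. quantile_time u w) \<in> borel_measurable ?F" if "length w < k" for w
    proof -
      have "(\<lambda>u. recentred_time (?S u) (\<lambda>w. ?e w u) w) \<in> borel_measurable ?F"
        using that by (intro measurable_recentred_time S_F e_F) (auto simp: G_def Suc_le_eq)
      then show ?thesis by (simp only: recentred_time_quantile_time)
    qed
    let ?q = "\<lambda>w t. \<integral>a. (indicator (B w) (q_quantile t a) :: real) \<partial>unif"
    have q_meas [measurable]: "?q w \<in> borel_measurable borel" for w
    proof (rule unif.borel_measurable_lebesgue_integral)
      have "(\<lambda>x. q_quantile (fst x) (snd x)) \<in> borel_measurable (borel \<Otimes>\<^sub>M unif)"
        by measurable
      from measurable_compose[OF this borel_measurable_indicator[OF B[of w]]]
      show "(\<lambda>(t, a). indicator (B w) (q_quantile t a) :: real) \<in> borel_measurable (borel \<Otimes>\<^sub>M unif)"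
        by (simp add: case_prod_beta')
    qed
    have qm: "q_quantile t \<in> borel_measurable unif" for t by measurable
    have q_le: "norm (?q w t) \<le> 1" "?q w t \<ge> 0" for w t
    proof -
      show "?q w t \<ge> 0" by simp
      have "?q w t = measure (q_inf t) (B w)" by (simp add: measure_q_inf)
      also have "\<dots> \<le> 1"
      proof -
        interpret q: real_distribution "q_inf t" by (rule real_distribution_q_inf)
        show ?thesis by simp
      qed
      finally show "norm (?q w t) \<le> 1" using \<open>?q w t \<ge> 0\<close> by simp
    qed
    let ?I = "\<lambda>u. \<Prod>w\<in>K. indicator (B w) (q_quantile (quantile_time u (butlast w)) (u w)) :: real"
    let ?H = "\<lambda>u. \<Prod>w\<in>K. ?q w (quantile_time u (butlast w))"
    have I_eq: "indicator {u \<in> space ?N. \<forall>w. length w = k \<longrightarrow> ?e w u \<in> B w} = ?I"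
    proof
      fix u
      show "indicator {u \<in> space ?N. \<forall>w. length w = k \<longrightarrow> ?e w u \<in> B w} u = ?I u"
        using JK(3) by (auto simp: indicator_def space_PiM prod_zero_iff K_def)
    qed
    have I_le: "norm (?I u) \<le> 1" for u
      unfolding prod_norm[symmetric] by (intro prod_le_1) (auto simp: indicator_def)
    have H_le: "norm (?H u) \<le> 1" for u
      unfolding prod_norm[symmetric] by (intro prod_le_1 conjI q_le) simp
    have key: "(\<integral>u\<in>A. ?I u \<partial>?N) = (\<integral>u\<in>A. ?H u \<partial>?N)" if "A \<in> sets ?F" for A
    proof -
      from that obtain C where C [measurable]: "C \<in> sets ?C" and A: "A = ?X -` C \<inter> space ?N"
        unfolding F_eq sets_vimage_algebra2[OF X_sp] by auto
      let ?c = "\<lambda>u. indicator C (?X u) :: real"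
      let ?L = "\<Pi>\<^sub>M w\<in>J \<union> K. unif"
      have X_cong: "?X u = ?X u'" if "\<And>w. w \<in> J \<Longrightarrow> u w = u' w" for u u'
      proof -
        have quantile_time: "quantile_time u w = quantile_time u' w" if "length w < k" for w
          using that \<open>\<And>w. w \<in> J \<Longrightarrow> u w = u' w\<close> by (intro quantile_time_cong) (auto simp: J_def)
        show ?thesis
          using k quantile_time[of "[]"] \<open>\<And>w. w \<in> J \<Longrightarrow> u w = u' w\<close>
          by (auto simp: fun_eq_iff restrict_def G_def J_def intro!: arg_cong2[where f=q_quantile] quantile_time)
      qed
      have comp [measurable]: "(\<lambda>u. u w) \<in> borel_measurable ?L" if "length w \<le> k" for w
      proof -
        have "(\<lambda>u. u w) \<in> measurable ?L unif"
          using that JK(4) by (intro measurable_component_singleton) auto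
        then show ?thesis
          using measurable_cong_sets[OF refl sets_unif] by blast
      qed
      have RL: "(\<lambda>u. quantile_time u w) \<in> borel_measurable ?L" if "length w \<le> k" for w
        using that by (intro measurable_quantile_time comp) auto
      have eL: "?e w \<in> borel_measurable ?L" if "length w \<le> k" for w
        using that by (intro measurable_q_quantile RL comp) auto
      have XL: "?X \<in> measurable ?L ?C"
        by (intro measurable_Pair measurable_restrict RL eL) (auto simp: G_def)
      have cL: "?c \<in> borel_measurable ?L"
        by (rule measurable_compose[OF XL]) simp
      have IL: "?I \<in> borel_measurable ?L"
      proof (rule borel_measurable_prod)
        fix w assume "w \<in> K"
        then have [measurable]: "?e w \<in> borel_measurable ?L" by (intro eL) (simp add: K_def)
        show "(\<lambda>u. indicator (B w) (?e w u) :: real) \<in> borel_measurable ?L" by measurable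
      qed
      have HL: "?H \<in> borel_measurable ?L"
      proof (rule borel_measurable_prod)
        fix w assume "w \<in> K"
        then have [measurable]: "(\<lambda>u. quantile_time u (butlast w)) \<in> borel_measurable ?L"
          by (intro RL) (simp add: K_def)
        show "(\<lambda>u. ?q w (quantile_time u (butlast w))) \<in> borel_measurable ?L"
          by (rule measurable_compose[OF _ q_meas]) measurable
      qed
      have L_prob: "prob_space ?L" by (rule prob_space_PiM) (rule prob_space_unif)
      have K_prob: "prob_space (\<Pi>\<^sub>M w\<in>K. unif)" by (rule prob_space_PiM) (rule prob_space_unif)
      have red: "(\<integral>u. ?c u * f u \<partial>?N)
          = (\<integral>x. (\<integral>y. ?c x * f (merge J K (x, y)) \<partial>(\<Pi>\<^sub>M w\<in>K. unif)) \<partial>(\<Pi>\<^sub>M w\<in>J. unif))"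
        if f: "f \<in> borel_measurable ?L" "\<And>u. norm (f u) \<le> 1"
          and fc: "\<And>u. f (restrict u (J \<union> K)) = f u" for f :: "(vertex \<Rightarrow> real) \<Rightarrow> real"
      proof -
        have "(\<integral>u. ?c u * f u \<partial>?N) = (\<integral>u. ?c (restrict u (J \<union> K)) * f (restrict u (J \<union> K)) \<partial>?N)"
        proof -
          have "?X (restrict u (J \<union> K)) = ?X u" for u
            by (rule X_cong) simp
          then show ?thesis by (simp only: fc)
        qed
        also have "\<dots> = (\<integral>u. ?c u * f u \<partial>distr ?N ?L (\<lambda>u. restrict u (J \<union> K)))"
          by (rule integral_distr[symmetric]) (intro measurable_restrict measurable_component_singleton UNIV_I borel_measurable_times cL f)+
        also have "distr ?N ?L (\<lambda>u. restrict u (J \<union> K)) = ?L"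
          using JK(2,3) by (intro PP.distr_PiM_restrict_finite) auto
        also have "(\<integral>u. ?c u * f u \<partial>?L)
           = (\<integral>x. (\<integral>y. ?c (merge J K (x, y)) * f (merge J K (x, y)) \<partial>(\<Pi>\<^sub>M w\<in>K. unif)) \<partial>(\<Pi>\<^sub>M w\<in>J. unif))"
        proof (rule PP.product_integral_fold)
          show "integrable ?L (\<lambda>u. ?c u * f u)"
          proof (rule finite_measure.integrable_const_bound[OF prob_space.finite_measure[OF L_prob], of _ 1])
            show "AE u in ?L. norm (?c u * f u) \<le> 1"
              using f(2) by (auto simp: indicator_def)
          qed (intro borel_measurable_times cL f)
        qed (use JK(1,2,3) in auto)
        also have "\<dots> = (\<integral>x. (\<integral>y. ?c x * f (merge J K (x, y)) \<partial>(\<Pi>\<^sub>M w\<in>K. unif)) \<partial>(\<Pi>\<^sub>M w\<in>J. unif))"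
        proof -
          have "?X (merge J K (x, y)) = ?X x" for x y
            by (rule X_cong) (simp add: merge_def)
          then show ?thesis by (simp only:)
        qed
        finally show ?thesis .
      qed
      have Rr: "quantile_time (restrict u (J \<union> K)) (butlast w) = quantile_time u (butlast w)"
        if "w \<in> K" for u w
        using bl[OF that] by (intro quantile_time_cong) (auto simp: JK(4))
      have Rm: "quantile_time (merge J K (x, y)) (butlast w) = quantile_time x (butlast w)" if "w \<in> K" for x y w
        using bl[OF that] by (intro quantile_time_cong) (auto simp: merge_def J_def)
      have "(\<integral>u\<in>A. ?I u \<partial>?N) = (\<integral>u. ?c u * ?I u \<partial>?N)"
        unfolding set_lebesgue_integral_def by (auto simp: A indicator_def space_PiM intro!: Bochner_Integration.integral_cong)
      also have "\<dots> = (\<integral>x. (\<integral>y. ?c x * ?I (merge J K (x, y)) \<partial>(\<Pi>\<^sub>M w\<in>K. unif)) \<partial>(\<Pi>\<^sub>M w\<in>J. unif))"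
        by (rule red[OF IL I_le]) (auto simp: Rr intro!: prod.cong)
      also have "\<dots> = (\<integral>x. (\<integral>y. ?c x * ?H (merge J K (x, y)) \<partial>(\<Pi>\<^sub>M w\<in>K. unif)) \<partial>(\<Pi>\<^sub>M w\<in>J. unif))"
      proof (rule Bochner_Integration.integral_cong[OF refl])
        fix x
        have Im: "?I (merge J K (x, y)) = (\<Prod>w\<in>K. indicator (B w) (q_quantile (quantile_time x (butlast w)) (y w)))" for y
          using JK(1) by (intro prod.cong refl) (simp add: Rm)
        have Hm: "?H (merge J K (x, y)) = ?H x" for y
          by (intro prod.cong refl) (simp add: Rm)
        have "(\<integral>y. ?I (merge J K (x, y)) \<partial>(\<Pi>\<^sub>M w\<in>K. unif)) = ?H x"
          unfolding Im
        proof (rule PP.product_integral_prod[OF JK(3)])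
          fix w
          from measurable_compose[OF qm borel_measurable_indicator[OF B[of w]]]
          show "integrable unif (\<lambda>a. indicator (B w) (q_quantile (quantile_time x (butlast w)) a) :: real)"
            by (intro unif.integrable_const_bound[of _ 1]) (auto simp: indicator_def)
        qed
        then show "(\<integral>y. ?c x * ?I (merge J K (x, y)) \<partial>(\<Pi>\<^sub>M w\<in>K. unif))
            = (\<integral>y. ?c x * ?H (merge J K (x, y)) \<partial>(\<Pi>\<^sub>M w\<in>K. unif))"
          unfolding Hm by (simp add: prob_space.prob_space[OF K_prob])
      qed
      also have "\<dots> = (\<integral>u. ?c u * ?H u \<partial>?N)"
        by (rule red[OF HL H_le, symmetric]) (auto simp: Rr intro!: prod.cong)
      also have "\<dots> = (\<integral>u\<in>A. ?H u \<partial>?N)"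
        unfolding set_lebesgue_integral_def by (auto simp: A indicator_def space_PiM intro!: Bochner_Integration.integral_cong)
      finally show ?thesis .
    qed
    have HF: "?H \<in> borel_measurable ?F"
      by (intro borel_measurable_prod measurable_compose[OF R_F q_meas] bl)
    have "AE u in ?N. real_cond_exp ?N ?F ?I u = ?H u"
    proof (rule F.real_cond_exp_charact[OF key])
      show "integrable ?N ?I"
      proof (rule PP.integrable_const_bound[of _ 1])
        show "?I \<in> borel_measurable ?N"
          by (intro borel_measurable_prod measurable_compose[OF e_meas borel_measurable_indicator[OF B]])
      qed (use I_le in simp)
      show "integrable ?N ?H"
        by (rule PP.integrable_const_bound[of _ 1])
          (use H_le in simp, rule measurable_from_subalg[OF subalg HF])
    qed (assumption, rule HF)
    then show ?thesis
      unfolding I_eq recentred_time_quantile_time K_def by (simp add: measure_q_inf)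
  qed
  show ?thesis
    unfolding limiting_model_def using S_law cond PP.prob_space_axioms by auto
qed

end

theory Submission
  imports Defs
begin

text \<open>
  The proof conditions on the label of the root. If the root branches at time \<open>r \<le> h\<close>, the
  population at time \<open>h\<close> is the sum of the populations of two independent copies of the tree at time
  \<open>h - r\<close>, so a weight \<open>s ^ n(h)\<close> factorises over the two subtrees
  (\<open>weighted_split_event\<close>). For the whole space this is a renewal equation with a single bounded
  solution, the generating function \<open>pgf s h\<close> of a geometric law (\<open>weighted_UNIV\<close>). Dividing by it
  gives the tree conditioned by the weight; its root label has density
  \<open>(pgf s (h - r))\<^sup>2 / pgf s h\<close> with respect to the exponential law as long as \<open>r \<le> h\<close>, and given
  this label the subtrees are again independent conditioned trees, observed for the time \<open>h - r\<close>.

  Put \<open>a = \<lambda> \<epsilon>\<^sup>2\<close>. Then \<open>\<sigma> = sech (sqrt (2 a)) = 1 - a + o(a)\<close>, so the weight becomes effective when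
  the population is of order \<open>1 / a\<close>, which takes the time \<open>- ln a\<close>. If the remaining time is
  \<open>- ln a - T\<close>, then \<open>pgf\<close> tends to \<open>1 / (1 + exp (- T))\<close>, and the density of the root label tends
  to \<open>(1 + exp (- T)) / (1 + exp (- r - T))\<^sup>2\<close>, which is the density of \<open>q_inf T\<close>; the subtrees
  are then at \<open>T + r\<close>. Induction over the generations and dominated convergence give the
  convergence of the conditioned law to the limiting law on cylinders. The densities of the
  conditioned laws with respect to the law of the unconditioned tree are at most \<open>1 / pgf\<close>, hence
  bounded, so limits may be exchanged with countable disjoint unions and Dynkin's lemma extends the
  convergence to every measurable set (\<open>converges\<close>).

  A first branching at time \<open>t + ln a + \<delta>\<close> leaves the time \<open>- ln a - \<delta>\<close> to the subtrees. In the
  variable \<open>\<delta>\<close> the density of the first branching time converges to the logistic density, and is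
  dominated by a multiple of it on \<open>\<delta> \<le> \<Delta>\<close>. This gives the limit as an integral over \<open>\<delta>\<close>
  (\<open>first_branching_converges\<close>).

  The limiting model is described generation by generation, whereas the limit just found is described
  by splitting at the root. The two are matched through the realisation by quantile functions: the
  defining properties determine the joint law (\<open>limiting_model_unique\<close>), and the labels of the
  quantile realisation are functions of i.i.d. uniform labels, which split at the root
  (\<open>quantile_model_split\<close>).
\<close>

section \<open>The space of labelled binary trees\<close>

abbreviation tree_borel :: "(vertex \<Rightarrow> real) measure" where
  "tree_borel \<equiv> \<Pi>\<^sub>M w\<in>UNIV. borel"

definition iid_tree :: "real measure \<Rightarrow> (vertex \<Rightarrow> real) measure" where
  "iid_tree D = (\<Pi>\<^sub>M w\<in>UNIV. D)"

definition subtree :: "bool \<Rightarrow> (vertex \<Rightarrow> real) \<Rightarrow> vertex \<Rightarrow> real" where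
  "subtree b x = (\<lambda>w. x (b # w))"

definition graft :: "real \<Rightarrow> (vertex \<Rightarrow> real) \<Rightarrow> (vertex \<Rightarrow> real) \<Rightarrow> vertex \<Rightarrow> real" where
  "graft r x y w = (case w of [] \<Rightarrow> r | b # v \<Rightarrow> if b then y v else x v)"

lemma graft_simps [simp]:
  "graft r x y [] = r" "subtree False (graft r x y) = x" "subtree True (graft r x y) = y"
  by (auto simp: graft_def subtree_def)

lemma space_tree_borel [simp]: "space tree_borel = UNIV"
  by (simp add: space_PiM)

lemma UNIV_in_tree_borel: "(UNIV :: (vertex \<Rightarrow> real) set) \<in> sets tree_borel"
  using sets.top[of tree_borel] by simp

lemma measurable_label: "(\<lambda>x. x w) \<in> borel_measurable tree_borel"
  by (rule measurable_component_singleton) simp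

lemma measurable_into_tree_borel:
  assumes "\<And>w. (\<lambda>x. f x w) \<in> borel_measurable M"
  shows "f \<in> measurable M tree_borel"
  using assms by (intro measurable_PiM_single') (auto simp: space_PiM)

lemma measurable_subtree [measurable]: "subtree b \<in> measurable tree_borel tree_borel"
  unfolding subtree_def by (intro measurable_into_tree_borel measurable_label)

text \<open>Cylinders restrict all labels of the first \<open>k\<close> generations at once, so that they are compatible
  both with splitting at the root and with passing from one generation to the next.\<close>

definition cylinder :: "nat \<Rightarrow> (vertex \<Rightarrow> real set) \<Rightarrow> (vertex \<Rightarrow> real) set" where
  "cylinder k B = {x. \<forall>w. length w < k \<longrightarrow> x w \<in> B w}"

lemma cylinder_0: "cylinder 0 B = UNIV"
  by (simp add: cylinder_def)

lemma cylinder_Suc: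
  "cylinder (Suc k) B = {x. x [] \<in> B [] \<and> subtree False x \<in> cylinder k (\<lambda>w. B (False # w)) \<and>
     subtree True x \<in> cylinder k (\<lambda>w. B (True # w))}" (is "_ = ?R")
proof (intro set_eqI iffI)
  fix x assume x: "x \<in> ?R"
  have "x w \<in> B w" if "length w < Suc k" for w
  proof (cases w)
    case Nil then show ?thesis using x by simp
  next
    case (Cons b v)
    then show ?thesis using x that by (cases b) (auto simp: cylinder_def subtree_def)
  qed
  then show "x \<in> cylinder (Suc k) B" by (simp add: cylinder_def)
qed (auto simp: cylinder_def subtree_def)

lemma sets_cylinder:
  assumes "\<And>w. B w \<in> sets borel"
  shows "cylinder k B \<in> sets tree_borel"
proof -
  have "cylinder k B = (\<Inter>w\<in>{w. length w < k}. {x \<in> space tree_borel. x w \<in> B w}) \<inter> space tree_borel"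
    by (auto simp: cylinder_def)
  also have "\<dots> \<in> sets tree_borel"
  proof (cases "k = 0")
    case False
    have "{x \<in> space tree_borel. x w \<in> B w} \<in> sets tree_borel" for w
      using measurable_sets[OF measurable_label[of w] assms[of w]] by (simp add: vimage_def)
    then show ?thesis using False
      by (intro sets.Int sets.finite_INT finite_words_less sets.top) (auto intro!: exI[of _ "[]"])
  qed (simp add: sets.top[of tree_borel, simplified])
  finally show ?thesis .
qed

definition cylinders :: "(vertex \<Rightarrow> real) set set" where
  "cylinders = {cylinder k B | k B. \<forall>w. B w \<in> sets borel}"

lemma Int_stable_cylinders: "Int_stable cylinders"
proof (rule Int_stableI)
  fix a b assume "a \<in> cylinders" "b \<in> cylinders"
  then obtain k B l C where a: "a = cylinder k B" "\<And>w. B w \<in> sets borel"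
    and b: "b = cylinder l C" "\<And>w. C w \<in> sets borel"
    by (auto simp: cylinders_def)
  have "a \<inter> b = cylinder (max k l) (\<lambda>w. (if length w < k then B w else UNIV) \<inter> (if length w < l then C w else UNIV))"
    unfolding a(1) b(1) cylinder_def less_max_iff_disj by (auto split: if_splits)
  moreover have "(if length w < k then B w else UNIV) \<inter> (if length w < l then C w else UNIV) \<in> sets borel" for w
    using a b by auto
  ultimately show "a \<inter> b \<in> cylinders" by (auto simp: cylinders_def)
qed

lemma sets_tree_borel_cylinders: "sets tree_borel = sigma_sets UNIV cylinders"
proof
  let ?G = "{{f \<in> \<Pi>\<^sub>E (i::vertex)\<in>UNIV. space borel. f i \<in> A} |i A. i \<in> UNIV \<and> A \<in> sets (borel::real measure)}"
  have eq: "sets tree_borel = sigma_sets UNIV ?G"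
    by (subst sets_PiM_single) (auto simp: PiE_UNIV_domain)
  have "?G \<subseteq> cylinders"
  proof
    fix X assume "X \<in> ?G"
    then obtain i A where X: "X = {f. f i \<in> A}" "A \<in> sets borel" by (auto simp: PiE_UNIV_domain)
    then have "X = cylinder (Suc (length i)) (\<lambda>w. if w = i then A else UNIV)"
      by (auto simp: cylinder_def)
    with X(2) show "X \<in> cylinders" unfolding cylinders_def by (intro CollectI exI conjI) auto
  qed
  then show "sets tree_borel \<subseteq> sigma_sets UNIV cylinders"
    unfolding eq by (rule sigma_sets_mono')
  have "cylinders \<subseteq> sets tree_borel" by (auto simp: cylinders_def sets_cylinder)
  then show "sigma_sets UNIV cylinders \<subseteq> sets tree_borel"
    using sets.sigma_sets_subset[of cylinders tree_borel] by simp
qed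

lemma measure_eqI_cylinders:
  assumes P: "sets P = sets tree_borel" "prob_space P" and Q: "sets Q = sets tree_borel"
    and eq: "\<And>k B. (\<And>w. B w \<in> sets borel) \<Longrightarrow> emeasure P (cylinder k B) = emeasure Q (cylinder k B)"
  shows "P = Q"
proof (rule measure_eqI_generator_eq[OF Int_stable_cylinders, of UNIV _ _ "\<lambda>_. UNIV"])
  show "emeasure P X = emeasure Q X" if "X \<in> cylinders" for X
    using that eq by (auto simp: cylinders_def)
  show "sets P = sigma_sets UNIV cylinders" "sets Q = sigma_sets UNIV cylinders"
    using P Q by (simp_all add: sets_tree_borel_cylinders)
  show "range (\<lambda>_::nat. UNIV) \<subseteq> cylinders"
    by (auto simp: cylinders_def intro!: exI[of _ 0] exI[of _ "\<lambda>_. UNIV"] cylinder_0[symmetric])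
  show "emeasure P UNIV \<noteq> \<infinity>" for i :: nat
    using finite_measure.emeasure_finite[OF prob_space.finite_measure[OF P(2)]] by simp
qed simp_all

section \<open>Independent labels: splitting at the root\<close>

locale tree_law =
  fixes D :: "real measure"
  assumes prob_D: "prob_space D" and sets_D [measurable_cong, simp]: "sets D = sets borel"
begin

sublocale D: prob_space D by (rule prob_D)

lemma space_D [simp]: "space D = UNIV"
  using sets_eq_imp_space_eq[OF sets_D] by simp

sublocale PP: product_prob_space "\<lambda>_::vertex. D" UNIV by standard

lemma sets_iid_tree [measurable_cong, simp]: "sets (iid_tree D) = sets tree_borel"
  unfolding iid_tree_def by (intro sets_PiM_cong) simp_all

lemma space_iid_tree [simp]: "space (iid_tree D) = UNIV"
  by (simp add: iid_tree_def space_PiM)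

sublocale T: prob_space "iid_tree D"
  unfolding iid_tree_def by (rule prob_space_PiM) (rule prob_D)

lemma prob_UNIV [simp]: "measure (iid_tree D) UNIV = 1"
  using T.prob_space by simp

lemma emeasure_cylinder:
  assumes "\<And>w. B w \<in> sets borel"
  shows "emeasure (iid_tree D) (cylinder k B) = (\<Prod>w | length w < k. emeasure D (B w))"
proof -
  have "cylinder k B = prod_emb UNIV (\<lambda>_. D) {w. length w < k} (\<Pi>\<^sub>E w\<in>{w. length w < k}. B w)"
    by (rule set_eqI) (simp add: cylinder_def prod_emb_def space_PiM PiE_UNIV_domain restrict_PiE_iff Pi_iff)
  then show ?thesis
    unfolding iid_tree_def using assms by (simp add: PP.emeasure_PiM_emb finite_words_less)
qed

abbreviation root_split :: "(real \<times> (vertex \<Rightarrow> real) \<times> (vertex \<Rightarrow> real)) measure" where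
  "root_split \<equiv> D \<Otimes>\<^sub>M (iid_tree D \<Otimes>\<^sub>M iid_tree D)"

sublocale TT: pair_prob_space "iid_tree D" "iid_tree D" ..
sublocale DTT: pair_prob_space D "iid_tree D \<Otimes>\<^sub>M iid_tree D" ..

lemma measurable_graft [measurable]:
  "(\<lambda>(r, x, y). graft r x y) \<in> measurable root_split tree_borel"
proof (rule measurable_into_tree_borel)
  fix w
  show "(\<lambda>p. (case p of (r, x, y) \<Rightarrow> graft r x y) w) \<in> borel_measurable root_split"
  proof (cases w)
    case Nil
    then show ?thesis by (simp add: case_prod_beta')
  next
    case (Cons b v)
    then show ?thesis by (cases b) (auto simp: case_prod_beta' graft_def
          intro!: measurable_compose[OF _ measurable_label])
  qed
qed

lemma prod_words_Suc:
  fixes f :: "vertex \<Rightarrow> 'b::comm_monoid_mult"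
  shows "(\<Prod>w | length w < Suc k. f w) =
    f [] * ((\<Prod>w | length w < k. f (False # w)) * (\<Prod>w | length w < k. f (True # w)))"
proof -
  let ?K = "{w::vertex. length w < k}"
  have eq: "{w. length w < Suc k} = insert [] ((#) False ` ?K \<union> (#) True ` ?K)"
  proof (intro set_eqI)
    fix w :: vertex
    show "w \<in> {w. length w < Suc k} \<longleftrightarrow> w \<in> insert [] ((#) False ` ?K \<union> (#) True ` ?K)"
      by (cases w) (auto simp: image_iff)
  qed
  show ?thesis unfolding eq
    by (subst prod.insert, simp add: finite_words_less, force, subst prod.union_disjoint)
      (auto simp: finite_words_less prod.reindex)
qed

text \<open>Both sides give a cylinder the product of the probabilities of its label sets, because a
  vertex is either the root or lies in exactly one of the two subtrees.\<close>

lemma distr_graft: "distr root_split tree_borel (\<lambda>(r, x, y). graft r x y) = iid_tree D"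
proof (rule measure_eqI_cylinders)
  show "prob_space (distr root_split tree_borel (\<lambda>(r, x, y). graft r x y))"
    by (rule DTT.prob_space_distr) measurable
  fix k and B :: "vertex \<Rightarrow> real set" assume B: "\<And>w. B w \<in> sets borel"
  show "emeasure (distr root_split tree_borel (\<lambda>(r, x, y). graft r x y)) (cylinder k B) =
      emeasure (iid_tree D) (cylinder k B)"
  proof (cases k)
    case 0
    then show ?thesis 
      using prob_space.emeasure_space_1[OF DTT.prob_space_distr[OF measurable_graft]]
         T.emeasure_space_1 by (simp add: cylinder_0)
  next
    case (Suc l)
    have "(\<lambda>(r, x, y). graft r x y) -` cylinder k B \<inter> space root_split =
        B [] \<times> cylinder l (\<lambda>w. B (False # w)) \<times> cylinder l (\<lambda>w. B (True # w))"
      unfolding Suc cylinder_Suc by (auto simp: space_pair_measure)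
    then show ?thesis
      by (subst emeasure_distr)
        (simp_all add: sets_cylinder B Suc TT.emeasure_pair_measure_Times
          T.emeasure_pair_measure_Times prod_words_Suc emeasure_cylinder)
  qed
qed simp_all

text \<open>The only form of Fubini's theorem needed below: once the root label is known, the integrand
  factorises over the two subtrees.\<close>

lemma integral_root_split:
  fixes \<phi> :: "(vertex \<Rightarrow> real) \<Rightarrow> real"
  assumes split: "\<And>r x y. \<phi> (graft r x y) = f r x * g r y"
    and f [measurable]: "case_prod f \<in> borel_measurable (borel \<Otimes>\<^sub>M tree_borel)"
    and g [measurable]: "case_prod g \<in> borel_measurable (borel \<Otimes>\<^sub>M tree_borel)"
    and \<phi> [measurable]: "\<phi> \<in> borel_measurable tree_borel" and bnd: "\<And>x. \<bar>\<phi> x\<bar> \<le> 1"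
  shows "(\<integral>x. \<phi> x \<partial>iid_tree D) =
    (\<integral>r. (\<integral>x. f r x \<partial>iid_tree D) * (\<integral>y. g r y \<partial>iid_tree D) \<partial>D)"
proof -
  have m: "(\<lambda>p. f (fst p) (fst (snd p)) * g (fst p) (snd (snd p))) \<in> borel_measurable root_split"
    by measurable
  have bnd': "\<bar>f r x * g r y\<bar> \<le> 1" for r x y
    using bnd[of "graft r x y"] by (simp add: split)
  have mr: "(\<lambda>p. f r (fst p) * g r (snd p)) \<in> borel_measurable (iid_tree D \<Otimes>\<^sub>M iid_tree D)" for r
    by measurable
  have "(\<integral>x. \<phi> x \<partial>iid_tree D) = (\<integral>p. \<phi> (case p of (r, x, y) \<Rightarrow> graft r x y) \<partial>root_split)"
    by (subst (1) distr_graft[symmetric], rule integral_distr) measurable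
  also have "\<dots> = (\<integral>p. f (fst p) (fst (snd p)) * g (fst p) (snd (snd p)) \<partial>root_split)"
    by (simp add: split case_prod_beta')
  also have "\<dots> = (\<integral>r. (\<integral>p. f r (fst p) * g r (snd p) \<partial>(iid_tree D \<Otimes>\<^sub>M iid_tree D)) \<partial>D)"
    by (subst DTT.integral_fst'[symmetric])
      (auto intro!: DTT.integrable_const_bound[of _ 1] m bnd')
  also have "\<dots> = (\<integral>r. (\<integral>x. (\<integral>y. f r x * g r y \<partial>iid_tree D) \<partial>iid_tree D) \<partial>D)"
    by (subst TT.integral_fst'[symmetric])
      (auto intro!: TT.integrable_const_bound[of _ 1] mr bnd')
  also have "\<dots> = (\<integral>r. (\<integral>x. f r x \<partial>iid_tree D) * (\<integral>y. g r y \<partial>iid_tree D) \<partial>D)"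
    by simp
  finally show ?thesis .
qed

end

section \<open>The population at a fixed time\<close>

lemma birth_time_Nil [simp]: "birth_time x [] = 0"
  by (simp add: birth_time.simps)

lemma birth_time_Cons: "birth_time x (b # w) = x [] + birth_time (subtree b x) w"
proof (induction w rule: rev_induct)
  case Nil
  show ?case by (simp add: birth_time.simps[of _ "[b]"])
next
  case (snoc a w)
  then show ?case
    by (simp add: birth_time.simps[of _ "b # w @ [a]"] birth_time.simps[of _ "w @ [a]"] subtree_def)
qed

lemma birth_time_nonneg: "(\<And>w. 0 \<le> x w) \<Longrightarrow> 0 \<le> birth_time x w"
proof (induction w rule: rev_induct)
  case (snoc a w)
  then show ?case by (simp add: birth_time.simps[of _ "w @ [a]"])
qed simp

text \<open>Nonnegativity of the labels is essential: with negative waiting times a descendant could be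
  alive before its ancestors have branched.\<close>

lemma alive_before_first_branching:
  assumes "\<And>w. 0 \<le> x w" "0 \<le> h" "h < x []"
  shows "alive x h = {[]}"
proof -
  have "w \<in> alive x h \<longleftrightarrow> w = []" for w
  proof (cases w)
    case (Cons b v)
    have "0 \<le> birth_time (subtree b x) v"
      by (rule birth_time_nonneg) (simp add: subtree_def assms)
    then show ?thesis using assms by (simp add: alive_def Cons birth_time_Cons)
  qed (use assms in \<open>simp add: alive_def\<close>)
  then show ?thesis by auto
qed

lemma alive_after_first_branching:
  assumes "x [] \<le> h"
  shows "alive x h = (#) False ` alive (subtree False x) (h - x []) \<union>
    (#) True ` alive (subtree True x) (h - x [])"
proof -
  have "w \<in> alive x h \<longleftrightarrow> w \<in> (#) False ` alive (subtree False x) (h - x []) \<union>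
    (#) True ` alive (subtree True x) (h - x [])" for w
  proof (cases w)
    case (Cons b v)
    then show ?thesis
      by (cases b) (auto simp: alive_def birth_time_Cons image_iff subtree_def)
  qed (use assms in \<open>simp add: alive_def image_iff\<close>)
  then show ?thesis by auto
qed

text \<open>Giving infinite populations the weight 0 makes the factorisation \<open>pgf_weight_root\<close> hold for
  every tree with nonnegative labels, and allows non-explosion to be derived from the case \<open>s = 1\<close>.\<close>

definition pgf_weight :: "real \<Rightarrow> (vertex \<Rightarrow> real) \<Rightarrow> real \<Rightarrow> real" where
  "pgf_weight s x h = (if finite (alive x h) then s ^ num_alive x h else 0)"

lemma pgf_weight_root:
  assumes "\<And>w. 0 \<le> x w" "0 \<le> h"
  shows "pgf_weight s x h = (if x [] \<le> h
    then pgf_weight s (subtree False x) (h - x []) * pgf_weight s (subtree True x) (h - x [])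
    else s)"
proof (cases "x [] \<le> h")
  case True
  have inj: "inj_on ((#) b) A" for b :: bool and A by (simp add: inj_on_def)
  have card: "card ((#) False ` A \<union> (#) True ` B) = card A + card B"
    if "finite A" "finite B" for A B :: "vertex set"
    using that by (subst card_Un_disjoint) (auto simp: card_image inj)
  show ?thesis
    unfolding pgf_weight_def num_alive_def alive_after_first_branching[of x h, OF True]
    using True by (auto simp: finite_image_iff inj card power_add)
next
  case False
  then show ?thesis
    unfolding pgf_weight_def num_alive_def using alive_before_first_branching[OF assms] by simp
qed

lemma pgf_weight_bounds:
  assumes "0 \<le> s" "s \<le> 1"
  shows "0 \<le> pgf_weight s x h" "pgf_weight s x h \<le> 1"
  using assms by (auto simp: pgf_weight_def power_le_one)

lemma measurable_birth_time [measurable]: "(\<lambda>x. birth_time x w) \<in> borel_measurable tree_borel"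
proof (induction w rule: rev_induct)
  case (snoc a w)
  then show ?case by (simp add: birth_time.simps[of _ "w @ [a]"] measurable_label)
qed simp

text \<open>Encoding the countable type by natural numbers reduces the claim to sets of natural numbers,
  which are finite iff they are bounded.\<close>

lemma measurable_card_countable:
  fixes S :: "'a \<Rightarrow> 'b::countable set"
  assumes S [measurable]: "\<And>i. Measurable.pred M (\<lambda>x. i \<in> S x)"
  shows "Measurable.pred M (\<lambda>x. finite (S x))" "(\<lambda>x. card (S x)) \<in> measurable M (count_space UNIV)"
proof -
  have inj: "inj_on to_nat A" for A :: "'b set" by (rule inj_on_subset[OF inj_to_nat]) simp
  have "i \<in> to_nat ` S x \<longleftrightarrow> i \<in> range (to_nat :: 'b \<Rightarrow> nat) \<and> (from_nat i :: 'b) \<in> S x" for i x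
    by (auto simp: image_iff)
  then have m [measurable]: "Measurable.pred M (\<lambda>x. i \<in> to_nat ` S x)" for i :: nat
    by simp
  have "(\<lambda>x. card (to_nat ` S x)) \<in> measurable M (count_space UNIV)"
    by (rule measurable_card) measurable
  then show "(\<lambda>x. card (S x)) \<in> measurable M (count_space UNIV)"
    by (simp add: card_image inj)
  have "finite (S x) \<longleftrightarrow> (\<exists>m. \<forall>n. n \<in> to_nat ` S x \<longrightarrow> n < m)" for x
    unfolding finite_image_iff[OF inj, symmetric] finite_nat_set_iff_bounded by blast
  then show "Measurable.pred M (\<lambda>x. finite (S x))"
    by simp
qed

lemma measurable_num_alive:
  assumes [measurable]: "f \<in> measurable M tree_borel" "g \<in> borel_measurable M"
  shows "Measurable.pred M (\<lambda>x. finite (alive (f x) (g x)))"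
    "(\<lambda>x. num_alive (f x) (g x)) \<in> measurable M (count_space UNIV)"
proof -
  have [measurable]: "(\<lambda>x. f x w) \<in> borel_measurable M" "(\<lambda>x. birth_time (f x) w) \<in> borel_measurable M" for w
    by (rule measurable_compose[OF assms(1) measurable_label]) measurable
  have "Measurable.pred M (\<lambda>x. w \<in> alive (f x) (g x))" for w
    unfolding alive_def mem_Collect_eq by measurable
  from measurable_card_countable[OF this] show "Measurable.pred M (\<lambda>x. finite (alive (f x) (g x)))"
    "(\<lambda>x. num_alive (f x) (g x)) \<in> measurable M (count_space UNIV)"
    by (simp_all add: num_alive_def)
qed

lemma measurable_pgf_weight [measurable (raw)]:
  assumes [measurable]: "f \<in> measurable M tree_borel" "g \<in> borel_measurable M"
  shows "(\<lambda>x. pgf_weight s (f x) (g x)) \<in> borel_measurable M"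
proof -
  note [measurable] = measurable_num_alive[OF assms]
  have "(\<lambda>x. s ^ num_alive (f x) (g x)) \<in> borel_measurable M"
    by (rule measurable_compose[OF measurable_num_alive(2)[OF assms]]) simp
  then show ?thesis unfolding pgf_weight_def by measurable
qed

section \<open>The law of the population size\<close>

definition expo :: "real measure" where
  "expo = density lborel (exponential_density 1)"

interpretation expo: tree_law expo
  by (rule tree_law.intro) (simp_all add: expo_def prob_space_exponential_density)

abbreviation wait_law :: "(vertex \<Rightarrow> real) measure" where
  "wait_law \<equiv> iid_tree expo"

lemma integral_expo:
  assumes [measurable]: "f \<in> borel_measurable borel"
  shows "(\<integral>r. f r \<partial>expo) = (\<integral>r. exponential_density 1 r * (f r :: real) \<partial>lborel)"
  unfolding expo_def by (subst integral_density) (auto simp: exponential_density_nonneg)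

lemma integral_expo_atMost:
  fixes f :: "real \<Rightarrow> real"
  assumes h: "0 \<le> h" and [measurable]: "f \<in> borel_measurable borel"
    and deriv: "\<And>r. 0 \<le> r \<Longrightarrow> r \<le> h \<Longrightarrow> (F has_real_derivative exp (- r) * f r) (at r)"
    and cont: "\<And>r. 0 \<le> r \<Longrightarrow> r \<le> h \<Longrightarrow> isCont f r"
  shows "(\<integral>r. indicator {..h} r * f r \<partial>expo) = F h - F 0"
proof -
  have "(\<integral>r. indicator {..h} r * f r \<partial>expo) =
      (\<integral>r. exp (- r) * f r * indicator {0..h} r \<partial>lborel)"
    by (subst integral_expo)
      (auto simp: exponential_density_def indicator_def intro!: Bochner_Integration.integral_cong)
  also have "\<dots> = F h - F 0"
    using h by (intro integral_FTC_Icc_real deriv continuous_intros cont) auto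
  finally show ?thesis .
qed

lemma measure_expo_atMost: "0 \<le> h \<Longrightarrow> measure expo {..h} = 1 - exp (- h)"
proof -
  assume "0 \<le> h"
  then have "(\<integral>r. indicator {..h} r * 1 \<partial>expo) = - exp (- h) - - exp (- 0)"
    by (rule integral_expo_atMost) (auto intro!: derivative_eq_intros)
  then show ?thesis by simp
qed

lemma AE_expo_nonneg: "AE r in expo. 0 \<le> r"
  unfolding expo_def by (subst AE_density) (auto simp: exponential_density_def)

lemma AE_wait_law_nonneg: "AE x in wait_law. \<forall>w. 0 \<le> x w"
  unfolding AE_all_countable
proof
  fix w
  show "AE x in wait_law. 0 \<le> x w"
    unfolding iid_tree_def by (rule expo.PP.AE_component) (auto intro: AE_expo_nonneg)
qed

definition weighted :: "real \<Rightarrow> real \<Rightarrow> (vertex \<Rightarrow> real) set \<Rightarrow> real" where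
  "weighted s h A = (\<integral>x. indicator A x * pgf_weight s x h \<partial>wait_law)"

lemma weighted_measurable [measurable (raw)]:
  assumes [measurable]: "A \<in> sets tree_borel" "f \<in> borel_measurable M"
  shows "(\<lambda>x. weighted s (f x) A) \<in> borel_measurable M"
  unfolding weighted_def by measurable

lemma integrable_weighted:
  assumes [measurable]: "A \<in> sets tree_borel" and s: "0 \<le> s" "s \<le> 1"
  shows "integrable wait_law (\<lambda>x. indicator A x * pgf_weight s x h)"
proof (rule expo.T.integrable_const_bound[of _ 1])
  show "AE x in wait_law. norm (indicator A x * pgf_weight s x h) \<le> 1"
    using pgf_weight_bounds[OF s] by (auto simp: indicator_def)
qed measurable

lemma weighted_bounds:
  assumes [measurable]: "A \<in> sets tree_borel" and s: "0 \<le> s" "s \<le> 1"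
  shows "0 \<le> weighted s h A" "weighted s h A \<le> measure wait_law A" "weighted s h A \<le> 1"
proof -
  show "0 \<le> weighted s h A"
    unfolding weighted_def using pgf_weight_bounds[OF s] by (intro Bochner_Integration.integral_nonneg) simp
  have "weighted s h A \<le> (\<integral>x. indicator A x \<partial>wait_law)"
    unfolding weighted_def using pgf_weight_bounds[OF s]
    by (intro integral_mono integrable_weighted integrable_real_indicator s)
      (auto simp: indicator_def expo.T.emeasure_eq_measure)
  then show "weighted s h A \<le> measure wait_law A" by simp
  then show "weighted s h A \<le> 1" using expo.T.prob_le_1[of A] by linarith
qed

definition split_event ::
    "real set \<Rightarrow> (vertex \<Rightarrow> real) set \<Rightarrow> (vertex \<Rightarrow> real) set \<Rightarrow> (vertex \<Rightarrow> real) set" where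
  "split_event R A0 A1 = {x. x [] \<in> R \<and> subtree False x \<in> A0 \<and> subtree True x \<in> A1}"

lemma sets_split_event [measurable]:
  assumes [measurable]: "R \<in> sets borel" "A0 \<in> sets tree_borel" "A1 \<in> sets tree_borel"
  shows "split_event R A0 A1 \<in> sets tree_borel"
proof -
  note [measurable] = measurable_label[of "[]"]
  have "split_event R A0 A1 = {x \<in> space tree_borel. x [] \<in> R \<and> subtree False x \<in> A0 \<and> subtree True x \<in> A1}"
    by (simp add: split_event_def)
  also have "\<dots> \<in> sets tree_borel" by measurable
  finally show ?thesis .
qed

text \<open>If the root branches after \<open>h\<close>, it is the only vertex alive and the weight \<open>s\<close> does not see
  the subtrees; otherwise the weight factorises over the two subtrees, which are independent.\<close>

lemma weighted_split_event:
  assumes s: "0 \<le> s" "s \<le> 1" and h: "0 \<le> h"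
    and [measurable]: "R \<in> sets borel" "A0 \<in> sets tree_borel" "A1 \<in> sets tree_borel"
  shows "weighted s h (split_event R A0 A1) = (\<integral>r. indicator R r *
    (if r \<le> h then weighted s (h - r) A0 * weighted s (h - r) A1
     else s * measure wait_law A0 * measure wait_law A1) \<partial>expo)"
proof -
  note [measurable] = measurable_label[of "[]"]
  let ?f = "\<lambda>r x. indicator R r * (if r \<le> h then indicator A0 x * pgf_weight s x (h - r) else s * indicator A0 x) :: real"
  let ?g = "\<lambda>r x. (if r \<le> h then indicator A1 x * pgf_weight s x (h - r) else indicator A1 x) :: real"
  let ?\<phi> = "\<lambda>x. ?f (x []) (subtree False x) * ?g (x []) (subtree True x)"
  have "AE x in wait_law. indicator (split_event R A0 A1) x * pgf_weight s x h = ?\<phi> x"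
    using AE_wait_law_nonneg
  proof eventually_elim
    case (elim x)
    then show ?case
      using pgf_weight_root[of x h s] h by (auto simp: split_event_def indicator_def)
  qed
  then have "weighted s h (split_event R A0 A1) = (\<integral>x. ?\<phi> x \<partial>wait_law)"
    unfolding weighted_def by (intro integral_cong_AE) measurable
  also have "\<dots> = (\<integral>r. (\<integral>x. ?f r x \<partial>wait_law) * (\<integral>y. ?g r y \<partial>wait_law) \<partial>expo)"
  proof (rule expo.integral_root_split)
    show "\<bar>?\<phi> x\<bar> \<le> 1" for x
    proof -
      have "\<bar>?f r x\<bar> \<le> 1" "\<bar>?g r x\<bar> \<le> 1" for r x
        using pgf_weight_bounds[OF s] s by (auto simp: indicator_def)
      then show ?thesis unfolding abs_mult[of "?f _ _"] by (intro mult_le_one) auto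
    qed
  qed (simp, measurable)
  also have "\<dots> = (\<integral>r. indicator R r *
    (if r \<le> h then weighted s (h - r) A0 * weighted s (h - r) A1
     else s * measure wait_law A0 * measure wait_law A1) \<partial>expo)"
  proof (rule Bochner_Integration.integral_cong[OF refl])
    fix r
    have eq: "(\<integral>x. ?f r x \<partial>wait_law) = indicator R r * (if r \<le> h then weighted s (h - r) A0 else s * measure wait_law A0)"
      "(\<integral>x. ?g r x \<partial>wait_law) = (if r \<le> h then weighted s (h - r) A1 else measure wait_law A1)"
      by (auto simp: weighted_def)
    show "(\<integral>x. ?f r x \<partial>wait_law) * (\<integral>y. ?g r y \<partial>wait_law) = indicator R r *
    (if r \<le> h then weighted s (h - r) A0 * weighted s (h - r) A1
     else s * measure wait_law A0 * measure wait_law A1)"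
      unfolding eq by simp
  qed
  finally show ?thesis .
qed

text \<open>The probability generating function of the geometric law with success probability \<open>exp (- h)\<close>
  on the positive integers.\<close>

definition pgf :: "real \<Rightarrow> real \<Rightarrow> real" where
  "pgf s h = s * exp (- h) / (1 - s + s * exp (- h))"

lemma pgf_denominator_pos: "0 \<le> s \<Longrightarrow> s \<le> 1 \<Longrightarrow> 0 < 1 - s + s * exp (- h)" for h s :: real
  by (cases "s = 0") (auto simp: add_nonneg_pos)

lemma pgf_bounds:
  assumes s: "0 \<le> s" "s \<le> 1" and h: "0 \<le> h"
  shows "0 \<le> pgf s h" "pgf s h \<le> 1"
  using pgf_denominator_pos[OF s, of h] s by (auto simp: pgf_def)

lemma pgf_measurable [measurable (raw)]:
  assumes [measurable]: "f \<in> borel_measurable M"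
  shows "(\<lambda>x. pgf s (f x)) \<in> borel_measurable M"
  unfolding pgf_def by measurable

text \<open>As a function of \<open>h\<close>, \<open>pgf s\<close> solves the differential equation \<open>u' = u\<^sup>2 - u\<close>. Hence
  \<open>- exp (- r) * pgf s (h - r)\<close> is an antiderivative of the integrand.\<close>

lemma pgf_renewal:
  assumes s: "0 \<le> s" "s \<le> 1" and h: "0 \<le> h"
  shows "pgf s h = (\<integral>r. indicator {..h} r * (pgf s (h - r))\<^sup>2 \<partial>expo) + s * exp (- h)"
proof -
  let ?F = "\<lambda>r. - exp (- r) * pgf s (h - r)"
  have "(\<integral>r. indicator {..h} r * (pgf s (h - r))\<^sup>2 \<partial>expo) = ?F h - ?F 0"
  proof (rule integral_expo_atMost[OF h])
    fix r
    have pos: "0 < 1 - s + s * exp (r - h)" using pgf_denominator_pos[OF s, of "h - r"] by simp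
    show "isCont (\<lambda>r. (pgf s (h - r))\<^sup>2) r"
      unfolding pgf_def using pos by (intro continuous_intros) auto
    show "(?F has_real_derivative exp (- r) * (pgf s (h - r))\<^sup>2) (at r)"
      unfolding pgf_def using pos
      by (auto intro!: derivative_eq_intros simp: divide_simps power2_eq_square)
  qed measurable
  then show ?thesis by (simp add: pgf_def)
qed

text \<open>Both sides are bounded solutions of the same renewal equation, and such a solution is unique.
  If \<open>d\<close> is the distance of two solutions with values in \<open>[0, 1]\<close>, then
  \<open>d h \<le> 2 * (\<integral>r. indicator {..h} r * d (h - r) \<partial>expo)\<close>. In the norm weighted by \<open>exp (- 3 * h)\<close> the
  right-hand side is a contraction with constant \<open>2 / (3 + 1) = 1 / 2\<close>; any rate above 1 would do.\<close>

lemma weighted_UNIV: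
  assumes s: "0 \<le> s" "s \<le> 1" and h: "0 \<le> h"
  shows "weighted s h UNIV = pgf s h"
proof -
  let ?u = "\<lambda>h. weighted s h UNIV"
  define d where "d h = \<bar>?u h - pgf s h\<bar>" for h
  note UNIV = UNIV_in_tree_borel
  note [measurable] = weighted_measurable[OF UNIV]
  have u: "0 \<le> ?u h" "?u h \<le> 1" for h by (intro weighted_bounds s UNIV)+
  note p = pgf_bounds[OF s]
  have d1: "d h \<le> 1" "0 \<le> d h" if "0 \<le> h" for h using u[of h] p[OF that] by (auto simp: d_def)
  have ren: "?u h = (\<integral>r. indicator {..h} r * (?u (h - r))\<^sup>2 \<partial>expo) + s * exp (- h)" if h: "0 \<le> h" for h
  proof -
    have "?u h = (\<integral>r. (if r \<le> h then ?u (h - r) * ?u (h - r) else s) \<partial>expo)"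
      using weighted_split_event[OF s h, of UNIV UNIV UNIV] UNIV
      by (simp add: split_event_def cong: if_cong)
    also have "\<dots> = (\<integral>r. indicator {..h} r * (?u (h - r))\<^sup>2 + s * indicator {h<..} r \<partial>expo)"
      by (intro Bochner_Integration.integral_cong) (auto simp: power2_eq_square indicator_def)
    also have "\<dots> = (\<integral>r. indicator {..h} r * (?u (h - r))\<^sup>2 \<partial>expo) + s * measure expo {h<..}"
    proof (subst Bochner_Integration.integral_add)
      show "integrable expo (\<lambda>r. indicator {..h} r * (?u (h - r))\<^sup>2)"
        by (rule expo.D.integrable_const_bound[of _ 1])
          (auto simp: indicator_def u abs_square_le_1)
    qed (auto simp: expo.D.emeasure_eq_measure)
    also have "measure expo {h<..} = exp (- h)"
    proof -
      have "{h<..} = UNIV - {..h}" by auto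
      then show ?thesis
        using expo.D.prob_compl[of "{..h}"] measure_expo_atMost[OF h] by simp
    qed
    finally show ?thesis .
  qed
  define m where "m = (SUP h\<in>{0..}. d h * exp (- 3 * h))"
  have bdd: "bdd_above ((\<lambda>h. d h * exp (- 3 * h)) ` {0..})"
  proof (rule bdd_aboveI2)
    fix h :: real assume "h \<in> {0..}"
    then show "d h * exp (- 3 * h) \<le> 1" using d1[of h] by (intro mult_le_one) auto
  qed
  have le_m: "d h \<le> m * exp (3 * h)" if "0 \<le> h" for h
  proof -
    have "d h * exp (- 3 * h) \<le> m"
      unfolding m_def using that by (intro cSUP_upper bdd) auto
    then have "d h * exp (- 3 * h) * exp (3 * h) \<le> m * exp (3 * h)" by (rule mult_right_mono) simp
    then show ?thesis by (simp add: mult.assoc exp_add[symmetric])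
  qed
  have m0: "0 \<le> m" using le_m[of 0] d1(2)[of 0] by simp
  have half: "d h * exp (- 3 * h) \<le> m / 2" if h: "0 \<le> h" for h
  proof -
    have int: "integrable expo (\<lambda>r. indicator {..h} r * (f (h - r))\<^sup>2)"
      if [measurable]: "f \<in> borel_measurable borel" and f: "\<And>h. 0 \<le> h \<Longrightarrow> 0 \<le> f h \<and> f h \<le> 1" for f :: "real \<Rightarrow> real"
      by (rule expo.D.integrable_const_bound[of _ 1]) (use f in \<open>auto simp: indicator_def abs_square_le_1\<close>)
    have "d h = \<bar>\<integral>r. indicator {..h} r * ((?u (h - r))\<^sup>2 - (pgf s (h - r))\<^sup>2) \<partial>expo\<bar>"
      unfolding d_def by (subst ren[OF h], subst pgf_renewal[OF s h], subst right_diff_distrib,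
          subst Bochner_Integration.integral_diff) (use u p in \<open>auto intro!: int\<close>)
    also have "\<dots> \<le> (\<integral>r. 2 * m * exp (3 * h) * (indicator {..h} r * exp (- 3 * r)) \<partial>expo)"
    proof (rule order_trans[OF integral_abs_bound integral_mono_AE])
      show "AE r in expo. \<bar>indicator {..h} r * ((?u (h - r))\<^sup>2 - (pgf s (h - r))\<^sup>2)\<bar>
          \<le> 2 * m * exp (3 * h) * (indicator {..h} r * exp (- 3 * r))"
      proof (rule AE_I2)
        fix r
        show "\<bar>indicator {..h} r * ((?u (h - r))\<^sup>2 - (pgf s (h - r))\<^sup>2)\<bar>
          \<le> 2 * m * exp (3 * h) * (indicator {..h} r * exp (- 3 * r))"
        proof (cases "r \<le> h")
          case True
          then have p': "0 \<le> pgf s (h - r)" "pgf s (h - r) \<le> 1" using p[of "h - r"] by auto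
          have "\<bar>(?u (h - r))\<^sup>2 - (pgf s (h - r))\<^sup>2\<bar> = d (h - r) * (?u (h - r) + pgf s (h - r))"
            unfolding d_def power2_eq_square square_diff_square_factored abs_mult using u[of "h - r"] p' by simp
          also have "\<dots> \<le> (m * exp (3 * (h - r))) * 2"
            using True u[of "h - r"] p' d1(2)[of "h - r"] m0 by (intro mult_mono le_m) auto
          also have "exp (3 * (h - r)) = exp (3 * h) * exp (- 3 * r)"
            by (simp add: exp_add[symmetric] algebra_simps)
          finally show ?thesis using True by (simp add: mult_ac)
        qed simp
      qed
      show "integrable expo (\<lambda>r. 2 * m * exp (3 * h) * (indicator {..h} r * exp (- 3 * r)))"
        using AE_expo_nonneg
        by (intro integrable_mult_right expo.D.integrable_const_bound[of _ 1]) (auto simp: indicator_def)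
      have "integrable expo (\<lambda>r. indicator {..h} r * (?u (h - r))\<^sup>2 - indicator {..h} r * (pgf s (h - r))\<^sup>2)"
        by (intro Bochner_Integration.integrable_diff int) (use u p in auto)
      then show "integrable expo (\<lambda>r. \<bar>indicator {..h} r * ((?u (h - r))\<^sup>2 - (pgf s (h - r))\<^sup>2)\<bar>)"
        by (simp add: right_diff_distrib)
    qed
    also have "\<dots> = 2 * m * exp (3 * h) * (\<integral>r. indicator {..h} r * exp (- 3 * r) \<partial>expo)"
      by simp
    also have "(\<integral>r. indicator {..h} r * exp (- 3 * r) \<partial>expo) = - exp (- 4 * h) / 4 - - exp (- 4 * 0) / 4"
      by (rule integral_expo_atMost[OF h])
        (auto intro!: derivative_eq_intros continuous_intros simp: exp_add[symmetric])
    also have "2 * m * exp (3 * h) * (- exp (- 4 * h) / 4 - - exp (- 4 * 0) / 4) \<le> 2 * m * exp (3 * h) * (1 / 4)"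
      using m0 by (intro mult_left_mono) auto
    finally have "d h * exp (- 3 * h) \<le> 2 * m * exp (3 * h) * (1 / 4) * exp (- 3 * h)"
      by (rule mult_right_mono) simp
    also have "\<dots> = m / 2 * (exp (3 * h) * exp (- 3 * h))" by simp
    also have "\<dots> = m / 2" unfolding exp_add[symmetric] by simp
    finally show ?thesis .
  qed
  have "m \<le> m / 2" unfolding m_def[symmetric] by (subst m_def, rule cSUP_least) (use half in auto)
  then have "m = 0" using m0 by simp
  then show ?thesis using le_m[OF h] d1(2)[OF h] by (simp add: d_def)
qed

section \<open>The limiting waiting times in a subtree\<close>

interpretation unif: tree_law unif
  by (rule tree_law.intro) (simp_all add: prob_space_unif)

text \<open>The recursions from the root for the model that starts at time \<open>T\<close> and obtains its waiting times
  from uniform labels \<open>u\<close> through quantile functions. \<open>label_time w T u\<close> is the time at which \<open>w\<close>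
  branches; recursion from the root makes it compatible with \<open>integral_root_split\<close>.\<close>

primrec label_time :: "vertex \<Rightarrow> real \<Rightarrow> (vertex \<Rightarrow> real) \<Rightarrow> real" where
  "label_time [] T u = T + q_quantile T (u [])"
| "label_time (b # w) T u = label_time w (T + q_quantile T (u [])) (subtree b u)"

definition limit_wait :: "real \<Rightarrow> (vertex \<Rightarrow> real) \<Rightarrow> vertex \<Rightarrow> real" where
  "limit_wait T u w = q_quantile (if w = [] then T else label_time (butlast w) T u) (u w)"

lemma label_time_snoc:
  "label_time (w @ [b]) T u = label_time w T u + q_quantile (label_time w T u) (u (w @ [b]))"
  by (induction w arbitrary: T u) (simp_all add: subtree_def)

lemma limit_wait_Nil [simp]: "limit_wait T u [] = q_quantile T (u [])"
  by (simp add: limit_wait_def)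

lemma subtree_limit_wait:
  "subtree b (limit_wait T u) = limit_wait (T + q_quantile T (u [])) (subtree b u)"
  by (auto simp: fun_eq_iff subtree_def limit_wait_def)

text \<open>Recursion from the parent and recursion from the root compute the same branching times.\<close>

lemma quantile_time_Cons:
  "quantile_time u (b # w) = label_time w (quantile_time u []) (subtree b u)"
proof (induction w rule: rev_induct)
  case Nil
  show ?case by (simp add: quantile_time.simps[of _ "[b]"] subtree_def)
next
  case (snoc a w)
  have "quantile_time u (b # w @ [a]) =
      quantile_time u (b # w) + q_quantile (quantile_time u (b # w)) (u (b # w @ [a]))"
    by (subst quantile_time.simps) simp
  then show ?case by (simp add: snoc label_time_snoc subtree_def)
qed

lemma quantile_waits_eq_limit_wait:
  "(\<lambda>w. q_quantile (quantile_time u (butlast (b # w))) (u (b # w))) =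
    limit_wait (quantile_time u []) (subtree b u)"
  by (auto simp: fun_eq_iff limit_wait_def quantile_time_Cons subtree_def)

lemma measurable_label_time [measurable (raw)]:
  assumes "f \<in> borel_measurable M" "g \<in> measurable M tree_borel"
  shows "(\<lambda>x. label_time w (f x) (g x)) \<in> borel_measurable M"
  using assms
proof (induction w arbitrary: f g)
  case Nil
  have [measurable]: "(\<lambda>x. g x []) \<in> borel_measurable M"
    by (rule measurable_compose[OF Nil(2) measurable_label])
  from Nil show ?case by simp
next
  case (Cons b w)
  have [measurable]: "(\<lambda>x. g x []) \<in> borel_measurable M"
    by (rule measurable_compose[OF Cons(3) measurable_label])
  note [measurable] = Cons(2,3)
  show ?case unfolding label_time.simps by (rule Cons(1)) measurable
qed

lemma measurable_limit_wait [measurable (raw)]: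
  assumes [measurable]: "f \<in> borel_measurable M" "g \<in> measurable M tree_borel"
  shows "(\<lambda>x. limit_wait (f x) (g x)) \<in> measurable M tree_borel"
proof (rule measurable_into_tree_borel)
  fix w
  have [measurable]: "(\<lambda>x. g x w) \<in> borel_measurable M"
    by (rule measurable_compose[OF assms(2) measurable_label])
  show "(\<lambda>x. limit_wait (f x) (g x) w) \<in> borel_measurable M"
    unfolding limit_wait_def by measurable
qed

definition limit_prob :: "real \<Rightarrow> (vertex \<Rightarrow> real) set \<Rightarrow> real" where
  "limit_prob T A = (\<integral>u. indicator A (limit_wait T u) \<partial>iid_tree unif)"

lemma limit_prob_measurable [measurable (raw)]:
  assumes [measurable]: "A \<in> sets tree_borel" "f \<in> borel_measurable M"
  shows "(\<lambda>x. limit_prob (f x) A) \<in> borel_measurable M"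
  unfolding limit_prob_def by measurable

lemma limit_prob_eq_measure:
  assumes [measurable]: "A \<in> sets tree_borel"
  shows "limit_prob T A = measure (distr (iid_tree unif) tree_borel (limit_wait T)) A"
proof -
  have "limit_prob T A = (\<integral>x. indicator A x \<partial>distr (iid_tree unif) tree_borel (limit_wait T))"
    unfolding limit_prob_def by (subst integral_distr) auto
  then show ?thesis by simp
qed

lemma limit_prob_bounds:
  assumes "A \<in> sets tree_borel"
  shows "0 \<le> limit_prob T A" "limit_prob T A \<le> 1"
proof -
  interpret prob_space "distr (iid_tree unif) tree_borel (limit_wait T)"
    by (rule unif.T.prob_space_distr) measurable
  show "0 \<le> limit_prob T A" "limit_prob T A \<le> 1"
    by (simp_all add: limit_prob_eq_measure assms)
qed

text \<open>Once the root has branched at \<open>T + r\<close>, each subtree is a copy of the model started at \<open>T + r\<close>.\<close>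

lemma limit_prob_split_event_q_inf:
  assumes [measurable]: "R \<in> sets borel" "A0 \<in> sets tree_borel" "A1 \<in> sets tree_borel"
  shows "limit_prob T (split_event R A0 A1) =
    (\<integral>r. indicator R r * (limit_prob (T + r) A0 * limit_prob (T + r) A1) \<partial>q_inf T)"
proof -
  have [measurable]: "q_quantile T \<in> borel_measurable borel" by measurable
  have m: "(\<lambda>r. indicator R r * (limit_prob (T + r) A0 * limit_prob (T + r) A1)) \<in> borel_measurable borel"
    by measurable
  have "limit_prob T (split_event R A0 A1) =
    (\<integral>a. (\<integral>x. indicator R (q_quantile T a) * indicator A0 (limit_wait (T + q_quantile T a) x) \<partial>iid_tree unif) *
      (\<integral>y. indicator A1 (limit_wait (T + q_quantile T a) y) \<partial>iid_tree unif) \<partial>unif)"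
    using measurable_label[of "[]", measurable] unfolding limit_prob_def
    by (intro unif.integral_root_split)
      (auto simp: split_event_def subtree_limit_wait indicator_def)
  also have "\<dots> = (\<integral>a. indicator R (q_quantile T a) *
      (limit_prob (T + q_quantile T a) A0 * limit_prob (T + q_quantile T a) A1) \<partial>unif)"
    by (simp add: limit_prob_def mult.assoc)
  also have "\<dots> = (\<integral>r. indicator R r * (limit_prob (T + r) A0 * limit_prob (T + r) A1)
      \<partial>distr unif borel (q_quantile T))"
    by (rule integral_distr[symmetric]) (simp_all add: m)
  finally show ?thesis by (simp only: distr_q_quantile)
qed

text \<open>The density of \<open>q_inf T\<close> with respect to the standard exponential law.\<close>

definition limit_ratio :: "real \<Rightarrow> real \<Rightarrow> real" where
  "limit_ratio T r = (1 + exp (- T)) / (1 + exp (- r - T))\<^sup>2"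

lemma limit_ratio_measurable [measurable]: "limit_ratio T \<in> borel_measurable borel"
  unfolding limit_ratio_def by measurable

lemma limit_ratio_nonneg: "0 \<le> limit_ratio T r"
  by (simp add: limit_ratio_def add_nonneg_nonneg)

lemma distributed_q_inf:
  "distributed (q_inf T) lborel (\<lambda>r. r) (\<lambda>r. exponential_density 1 r * limit_ratio T r)"
proof (rule distributedI_borel_atMost[where g = "q_inf_cdf T"])
  interpret real_distribution "q_inf T" by (rule real_distribution_q_inf)
  show "(\<lambda>r. r) \<in> borel_measurable (q_inf T)" by simp
  show "(\<lambda>r. exponential_density 1 r * limit_ratio T r) \<in> borel_measurable borel" by measurable
  show "AE r in lborel. 0 \<le> exponential_density 1 r * limit_ratio T r"
    by (simp add: exponential_density_nonneg limit_ratio_nonneg)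
  fix a
  show "emeasure (q_inf T) {x \<in> space (q_inf T). x \<le> a} = ennreal (q_inf_cdf T a)"
    unfolding cdf_q_inf[symmetric] cdf_def by (simp add: emeasure_eq_measure atMost_def)
  show "(\<integral>\<^sup>+r. ennreal (exponential_density 1 r * limit_ratio T r * indicator {..a} r) \<partial>lborel) =
      ennreal (q_inf_cdf T a)"
  proof (cases "a < 0")
    case True
    then have "exponential_density 1 r * limit_ratio T r * indicator {..a} r = 0" for r
      by (auto simp: exponential_density_def indicator_def)
    then show ?thesis using True by (simp only:) (simp add: q_inf_cdf_def)
  next
    case False
    let ?F = "\<lambda>r. (1 - exp (- r)) / (exp (- r - T) + 1)"
    have "(\<integral>\<^sup>+r. ennreal (exponential_density 1 r * limit_ratio T r * indicator {..a} r) \<partial>lborel) =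
       (\<integral>\<^sup>+r. ennreal (exp (- r) * limit_ratio T r) * indicator {0..a} r \<partial>lborel)"
      by (intro nn_integral_cong) (auto simp: exponential_density_def indicator_def)
    also have "\<dots> = ?F a - ?F 0"
    proof (rule nn_integral_FTC_Icc)
      fix r
      have pos: "0 < exp (- r - T) + 1" by (simp add: add_pos_pos)
      have e: "exp (- r - T) = exp (- r) * exp (- T)" by (simp add: exp_add[symmetric])
      show "(?F has_real_derivative exp (- r) * limit_ratio T r) (at r)"
      proof -
        have "(?F has_real_derivative
          (exp (- r) * (exp (- r - T) + 1) - (1 - exp (- r)) * - exp (- r - T)) / ((exp (- r - T) + 1) * (exp (- r - T) + 1))) (at r)"
          using pos by (auto intro!: derivative_eq_intros)
        also have "exp (- r) * (exp (- r - T) + 1) - (1 - exp (- r)) * - exp (- r - T) = exp (- r) * (1 + exp (- T))"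
          by (simp add: e algebra_simps)
        finally show ?thesis by (simp add: limit_ratio_def power2_eq_square add.commute)
      qed
    qed (use False limit_ratio_nonneg in \<open>auto\<close>)
    finally show ?thesis using False by (simp add: q_inf_cdf_def)
  qed
qed

text \<open>Exponential labels are the common reference measure in which the root recursions of the
  conditioned tree and of the limiting tree are compared.\<close>

lemma integral_q_inf:
  assumes [measurable]: "f \<in> borel_measurable borel"
  shows "(\<integral>r. f r \<partial>q_inf T) = (\<integral>r. limit_ratio T r * f r \<partial>expo)"
proof -
  have "(\<integral>r. f r \<partial>q_inf T) = (\<integral>r. exponential_density 1 r * limit_ratio T r * f r \<partial>lborel)"
    by (rule distributed_integral[OF distributed_q_inf, symmetric])
      (simp_all add: exponential_density_nonneg limit_ratio_nonneg)
  then show ?thesis by (simp add: integral_expo mult.assoc)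
qed

lemma limit_prob_split_event:
  assumes [measurable]: "R \<in> sets borel" "A0 \<in> sets tree_borel" "A1 \<in> sets tree_borel"
  shows "limit_prob T (split_event R A0 A1) =
    (\<integral>r. limit_ratio T r * (indicator R r * (limit_prob (T + r) A0 * limit_prob (T + r) A1)) \<partial>expo)"
  by (subst limit_prob_split_event_q_inf) (auto intro!: integral_q_inf)

section \<open>The limiting model started from the distant past\<close>

definition logistic_density :: "real \<Rightarrow> real" where
  "logistic_density \<delta> = exp (- \<delta>) / (1 + exp (- \<delta>))\<^sup>2"

lemma logistic_density_measurable [measurable]: "logistic_density \<in> borel_measurable borel"
  unfolding logistic_density_def by measurable

lemma logistic_density_nonneg: "0 \<le> logistic_density \<delta>"
  by (simp add: logistic_density_def)

lemma nn_integral_logistic_density: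
  "(\<integral>\<^sup>+x. ennreal (logistic_density x * indicator {..a} x) \<partial>lborel) = ennreal (1 / (1 + exp (- a)))"
proof -
  let ?F = "\<lambda>x::real. - 1 / (1 + exp x)"
  have "(\<integral>\<^sup>+x. ennreal (logistic_density x * indicator {..a} x) \<partial>lborel) =
      (\<integral>\<^sup>+x. ennreal (logistic_density (- x)) * indicator {- a..} x \<partial>lborel)"
    by (subst nn_integral_real_affine[of _ "- 1" 0])
      (auto intro!: nn_integral_cong simp: indicator_def)
  also have "\<dots> = ennreal (0 - ?F (- a))"
  proof (rule nn_integral_FTC_atLeast)
    fix x :: real
    have "1 + exp x \<noteq> 0" by (metis add_pos_pos exp_gt_zero less_irrefl zero_less_one)
    then show "(?F has_real_derivative logistic_density (- x)) (at x)"
      by (auto intro!: derivative_eq_intros simp: logistic_density_def power2_eq_square)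
    show "0 \<le> logistic_density (- x)" by (rule logistic_density_nonneg)
  next
    show "(?F \<longlongrightarrow> 0) at_top"
      by (intro tendsto_divide_0[OF tendsto_const] filterlim_at_top_imp_at_infinity
          filterlim_tendsto_add_at_top[OF tendsto_const] exp_at_top)
  qed measurable
  finally show ?thesis by simp
qed

abbreviation quantile_law :: "(vertex \<Rightarrow> real) measure" where
  "quantile_law \<equiv> \<Pi>\<^sub>M w\<in>UNIV. unif"

lemma distributed_quantile_time_root:
  "distributed quantile_law lborel (\<lambda>u. quantile_time u []) logistic_density"
proof (rule distributedI_borel_atMost[where g = "\<lambda>a. 1 / (1 + exp (- a))"])
  note lm = limiting_model_exists[unfolded limiting_model_def]
  interpret prob_space quantile_law using lm by blast
  show "(\<lambda>u. quantile_time u []) \<in> borel_measurable quantile_law" using lm by blast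
  show "emeasure quantile_law {u \<in> space quantile_law. quantile_time u [] \<le> a} = ennreal (1 / (1 + exp (- a)))" for a
    using lm by (simp add: unif.PP.emeasure_eq_measure)
qed (simp_all add: logistic_density_nonneg nn_integral_logistic_density)

text \<open>Given the root label, the waiting times in the two subtrees are independent copies of the model
  started at the branching time \<open>\<delta>\<close> of the root, and this time has the logistic density.\<close>

lemma quantile_model_split:
  assumes [measurable]: "A0 \<in> sets tree_borel" "A1 \<in> sets tree_borel"
  defines "x \<equiv> \<lambda>u b w. q_quantile (quantile_time u (butlast (b # w))) (u (b # w))"
  shows "measure quantile_law {u. quantile_time u [] \<le> \<Delta> \<and> x u False \<in> A0 \<and> x u True \<in> A1} =
    (\<integral>\<delta>. logistic_density \<delta> * (indicator {..\<Delta>} \<delta> * (limit_prob \<delta> A0 * limit_prob \<delta> A1)) \<partial>lborel)"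
proof -
  let ?E = "{u. quantile_time u [] \<le> \<Delta> \<and> x u False \<in> A0 \<and> x u True \<in> A1}"
  let ?l = "\<lambda>a. ln (a / (1 - a)) :: real"
  let ?h = "\<lambda>\<delta>. indicator {..\<Delta>} \<delta> * (limit_prob \<delta> A0 * limit_prob \<delta> A1)"
  note [measurable] = measurable_label[of "[]"]
  have l: "quantile_time u [] = ?l (u [])" for u by (simp add: quantile_time.simps)
  have x: "x u b = limit_wait (?l (u [])) (subtree b u)" for u b
    unfolding x_def quantile_waits_eq_limit_wait l ..
  have law: "quantile_law = iid_tree unif" by (simp add: iid_tree_def)
  have E: "?E = {u \<in> space tree_borel. ?l (u []) \<le> \<Delta> \<and>
      limit_wait (?l (u [])) (subtree False u) \<in> A0 \<and> limit_wait (?l (u [])) (subtree True u) \<in> A1}"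
    unfolding x l by simp
  have [measurable]: "?E \<in> sets tree_borel"
    unfolding E by measurable
  have "measure quantile_law ?E = (\<integral>u. indicator ?E u \<partial>iid_tree unif)"
    by (simp add: law)
  also have "\<dots> =
    (\<integral>a. (\<integral>u. indicator {..\<Delta>} (?l a) * indicator A0 (limit_wait (?l a) u) \<partial>iid_tree unif) *
      (\<integral>u. indicator A1 (limit_wait (?l a) u) \<partial>iid_tree unif) \<partial>unif)"
    by (rule unif.integral_root_split) (auto simp: E indicator_def)
  also have "\<dots> = (\<integral>a. (\<integral>u. ?h (?l a) \<partial>iid_tree unif) * (\<integral>u. 1 \<partial>iid_tree unif) \<partial>unif)"
    by (simp add: limit_prob_def mult.assoc unif.T.prob_space[simplified])
  \<comment> \<open>The constant factors 1 let the splitting rule be read backwards: the root label of the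
    tree is a single uniform variable.\<close>
  also have "\<dots> = (\<integral>u. ?h (?l (u [])) \<partial>iid_tree unif)"
  proof (rule unif.integral_root_split[symmetric])
    fix u
    show "\<bar>?h (?l (u []))\<bar> \<le> 1"
      using limit_prob_bounds[OF assms(1)] limit_prob_bounds[OF assms(2)]
      by (auto simp: indicator_def abs_mult intro!: mult_le_one)
  qed (simp, measurable)
  also have "\<dots> = (\<integral>u. ?h (quantile_time u []) \<partial>quantile_law)"
    by (simp add: l law)
  also have "\<dots> = (\<integral>\<delta>. logistic_density \<delta> * ?h \<delta> \<partial>lborel)"
    by (rule distributed_integral[OF distributed_quantile_time_root, symmetric])
      (simp_all add: logistic_density_nonneg)
  finally show ?thesis .
qed

section \<open>Uniqueness in law of the limiting model\<close>

text \<open>The recentred branching time takes the place of the root label, so that the whole model is one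
  random labelled tree.\<close>

definition labels :: "('a \<Rightarrow> real) \<Rightarrow> (vertex \<Rightarrow> 'a \<Rightarrow> real) \<Rightarrow> 'a \<Rightarrow> vertex \<Rightarrow> real" where
  "labels S e \<omega> w = (if w = [] then S \<omega> else e w \<omega>)"

lemma recentred_time_cong:
  assumes "\<And>v. v \<noteq> [] \<Longrightarrow> length v \<le> length w \<Longrightarrow> x v = y v"
  shows "recentred_time s x w = recentred_time s y w"
  using assms
  by (induction w rule: length_induct) (auto simp: recentred_time.simps[of s x] recentred_time.simps[of s y])

text \<open>Filling up with 0 keeps the first \<open>j\<close> generations inside the fixed space of labelled trees,
  instead of a product space that depends on \<open>j\<close>.\<close>

definition truncate :: "nat \<Rightarrow> (vertex \<Rightarrow> real) \<Rightarrow> vertex \<Rightarrow> real" where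
  "truncate j y w = (if length w < j then y w else 0)"

lemma measurable_truncate [measurable]: "truncate j \<in> measurable tree_borel tree_borel"
proof (rule measurable_into_tree_borel)
  show "(\<lambda>x. truncate j x w) \<in> borel_measurable tree_borel" for w
    using measurable_label[of w] by (cases "length w < j") (simp_all add: truncate_def)
qed

lemma truncate_in_cylinder_iff:
  "truncate j y \<in> cylinder k B \<longleftrightarrow>
    y \<in> cylinder j (\<lambda>w. if length w < k then B w else UNIV) \<and>
    (\<forall>w. length w < k \<longrightarrow> j \<le> length w \<longrightarrow> 0 \<in> B w)"
  unfolding cylinder_def truncate_def mem_Collect_eq
  by (auto simp: not_less split: if_splits)

text \<open>After truncation every cylinder is decided by the first \<open>j\<close> generations, since the labels below are
  constant.\<close>

lemma truncated_law_eq: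
  assumes P: "prob_space P" "sets P = sets tree_borel" and Q: "prob_space Q" "sets Q = sets tree_borel"
    and eq: "\<And>B. (\<And>w. B w \<in> sets borel) \<Longrightarrow> emeasure P (cylinder j B) = emeasure Q (cylinder j B)"
  shows "distr P tree_borel (truncate j) = distr Q tree_borel (truncate j)"
proof -
  have m: "truncate j \<in> measurable P tree_borel" "truncate j \<in> measurable Q tree_borel"
    using measurable_truncate by (simp_all cong: measurable_cong_sets add: P Q)
  have sp: "space P = UNIV" "space Q = UNIV"
    using sets_eq_imp_space_eq[OF P(2)] sets_eq_imp_space_eq[OF Q(2)] by simp_all
  show ?thesis
  proof (rule measure_eqI_cylinders)
    show "prob_space (distr P tree_borel (truncate j))"
      using P m by (intro prob_space.prob_space_distr)
    fix k and B :: "vertex \<Rightarrow> real set" assume B: "\<And>w. B w \<in> sets borel"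
    let ?B = "\<lambda>w. if length w < k then B w else UNIV"
    have "truncate j -` cylinder k B =
        (if \<forall>w. length w < k \<longrightarrow> j \<le> length w \<longrightarrow> 0 \<in> B w then cylinder j ?B else {})"
      by (auto simp: truncate_in_cylinder_iff)
    moreover have "emeasure P (cylinder j ?B) = emeasure Q (cylinder j ?B)"
      using B by (intro eq) auto
    ultimately show "emeasure (distr P tree_borel (truncate j)) (cylinder k B) =
        emeasure (distr Q tree_borel (truncate j)) (cylinder k B)"
      by (simp add: emeasure_distr m sets_cylinder B sp)
  qed simp_all
qed

lemma measurable_measure_q_inf:
  assumes [measurable]: "B \<in> sets borel"
  shows "(\<lambda>T. measure (q_inf T) B) \<in> borel_measurable borel"
  unfolding measure_q_inf[OF assms] by measurable

text \<open>The conditional probability that all labels of generation \<open>j\<close> lie in the sets \<open>B\<close>, as a function of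
  the labels of the earlier generations.\<close>

definition next_generation :: "nat \<Rightarrow> (vertex \<Rightarrow> real set) \<Rightarrow> (vertex \<Rightarrow> real) \<Rightarrow> real" where
  "next_generation j B y =
    (\<Prod>w | length w = j. measure (q_inf (recentred_time (y []) y (butlast w))) (B w))"

lemma measurable_next_generation:
  assumes "\<And>w. B w \<in> sets borel"
  shows "next_generation j B \<in> borel_measurable tree_borel"
  unfolding next_generation_def
  by (intro borel_measurable_prod measurable_compose[OF _ measurable_measure_q_inf]
      measurable_recentred_time measurable_label assms)

lemma next_generation_truncate:
  assumes "1 \<le> j"
  shows "next_generation j B (truncate j y) = next_generation j B y"
  unfolding next_generation_def
proof (intro prod.cong refl)
  fix w :: vertex assume "w \<in> {w. length w = j}"
  then have "recentred_time s (truncate j y) (butlast w) = recentred_time s y (butlast w)" for s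
    using assms by (intro recentred_time_cong) (auto simp: truncate_def)
  moreover have "truncate j y [] = y []" using assms by (simp add: truncate_def)
  ultimately show "measure (q_inf (recentred_time (truncate j y []) (truncate j y) (butlast w))) (B w) =
      measure (q_inf (recentred_time (y []) y (butlast w))) (B w)"
    by simp
qed

lemma measurable_labels:
  assumes "limiting_model N S e"
  shows "labels S e \<in> measurable N tree_borel"
proof (rule measurable_into_tree_borel)
  show "(\<lambda>x. labels S e x w) \<in> borel_measurable N" for w
    using assms by (cases "w = []") (auto simp: labels_def limiting_model_def)
qed

text \<open>The event that the earlier generations lie in the cylinder belongs to \<open>past N S e j\<close>, so the
  indicator of the event for generation \<open>j\<close> may be replaced by its conditional expectation.\<close>

lemma labels_next_generation:
  assumes lm: "limiting_model N S e" and j: "1 \<le> j" and B: "\<And>w. B w \<in> sets borel"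
  shows "measure N {\<omega> \<in> space N. labels S e \<omega> \<in> cylinder (Suc j) B} =
    (\<integral>\<omega>. indicator (cylinder j B) (labels S e \<omega>) * next_generation j B (labels S e \<omega>) \<partial>N)"
proof -
  interpret N: prob_space N using lm by (simp add: limiting_model_def)
  define G :: "vertex set" where "G = {w. 1 \<le> length w \<and> length w < j}"
  have fG: "finite G" by (rule finite_subset[OF _ finite_words_less[of j]]) (auto simp: G_def)
  have S [measurable]: "S \<in> borel_measurable N" and e: "\<And>w. w \<in> G \<Longrightarrow> e w \<in> borel_measurable N"
    using lm by (auto simp: limiting_model_def G_def Suc_le_eq)
  let ?X = "\<lambda>\<omega>. (S \<omega>, \<lambda>w\<in>G. e w \<omega>)"
  let ?C = "borel \<Otimes>\<^sub>M (\<Pi>\<^sub>M w\<in>G. borel) :: (real \<times> (vertex \<Rightarrow> real)) measure"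
  let ?F = "past N S e j"
  have F_eq: "?F = vimage_algebra (space N) ?X ?C"
    by (simp add: past_def G_def)
  have X_sp: "?X \<in> space N \<rightarrow> space ?C" by (auto simp: space_pair_measure space_PiM)
  have X_meas: "?X \<in> measurable N ?C"
    by (intro measurable_Pair measurable_restrict S e)
  have "subalgebra N ?F"
    unfolding subalgebra_def F_eq sets_vimage_algebra2[OF X_sp]
    using measurable_sets[OF X_meas] by auto
  then interpret F: finite_measure_subalgebra N ?F by unfold_locales
  let ?A = "{\<omega> \<in> space N. labels S e \<omega> \<in> cylinder j B}"
  let ?I = "{\<omega> \<in> space N. \<forall>w. length w = j \<longrightarrow> e w \<omega> \<in> B w}"
  have "?A = ?X -` (B [] \<times> (\<Pi>\<^sub>E w\<in>G. B w)) \<inter> space N"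
  proof (intro set_eqI)
    fix \<omega>
    have "(\<forall>w. length w < j \<longrightarrow> labels S e \<omega> w \<in> B w) \<longleftrightarrow> S \<omega> \<in> B [] \<and> (\<forall>w\<in>G. e w \<omega> \<in> B w)"
    proof (intro iffI conjI)
      assume "\<forall>w. length w < j \<longrightarrow> labels S e \<omega> w \<in> B w"
      note * = this[rule_format]
      show "S \<omega> \<in> B []" using *[of "[]"] j by (simp add: labels_def)
      show "\<forall>w\<in>G. e w \<omega> \<in> B w"
      proof
        fix w assume "w \<in> G"
        then show "e w \<omega> \<in> B w" using *[of w] by (cases w) (auto simp: G_def labels_def)
      qed
    next
      assume a: "S \<omega> \<in> B [] \<and> (\<forall>w\<in>G. e w \<omega> \<in> B w)"
      show "\<forall>w. length w < j \<longrightarrow> labels S e \<omega> w \<in> B w"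
      proof (intro allI impI)
        fix w :: vertex assume "length w < j"
        then show "labels S e \<omega> w \<in> B w" using a by (cases w) (auto simp: labels_def G_def)
      qed
    qed
    then show "\<omega> \<in> ?A \<longleftrightarrow> \<omega> \<in> ?X -` (B [] \<times> (\<Pi>\<^sub>E w\<in>G. B w)) \<inter> space N"
      by (auto simp: cylinder_def)
  qed
  then have A: "?A \<in> sets ?F"
    unfolding F_eq sets_vimage_algebra2[OF X_sp]
    by (auto intro!: exI[of _ "B [] \<times> (\<Pi>\<^sub>E w\<in>G. B w)"] pair_measureI sets_PiM_I_finite fG B)
  have e_meas: "w \<noteq> [] \<Longrightarrow> e w \<in> borel_measurable N" for w
    using lm by (auto simp: limiting_model_def)
  have I: "?I \<in> sets N"
  proof -
    have "?I = (\<Inter>w\<in>{w. length w = j}. e w -` B w \<inter> space N)"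
      using exI[of "\<lambda>w::vertex. length w = j", OF length_replicate[of j True]] by auto
    also have "\<dots> \<in> sets N"
      using j B exI[of "\<lambda>w::vertex. length w = j", OF length_replicate[of j True]]
      by (intro sets.finite_INT finite_words measurable_sets[OF e_meas]) auto
    finally show ?thesis .
  qed
  have "AE \<omega> in N. real_cond_exp N ?F (indicator ?I) \<omega> =
      (\<Prod>w | length w = j. measure (q_inf (recentred_time (S \<omega>) (\<lambda>u. e u \<omega>) (butlast w))) (B w))"
    using lm j B unfolding limiting_model_def by blast
  moreover have "(\<Prod>w | length w = j. measure (q_inf (recentred_time (S \<omega>) (\<lambda>u. e u \<omega>) (butlast w))) (B w)) =
      next_generation j B (labels S e \<omega>)" for \<omega>
  proof -
    have "recentred_time (S \<omega>) (\<lambda>u. e u \<omega>) w = recentred_time (labels S e \<omega> []) (labels S e \<omega>) w" for w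
      unfolding labels_def[of S e \<omega> "[]"] by (simp, rule recentred_time_cong) (simp add: labels_def)
    then show ?thesis by (simp add: next_generation_def)
  qed
  ultimately have ce: "AE \<omega> in N. real_cond_exp N ?F (indicator ?I) \<omega> = next_generation j B (labels S e \<omega>)"
    by simp
  have AN: "?A \<in> sets N" using A F.subalg by (auto simp: subalgebra_def)
  have "measure N {\<omega> \<in> space N. labels S e \<omega> \<in> cylinder (Suc j) B} = measure N (?A \<inter> ?I)"
  proof -
    have "labels S e \<omega> \<in> cylinder (Suc j) B \<longleftrightarrow>
      labels S e \<omega> \<in> cylinder j B \<and> (\<forall>w. length w = j \<longrightarrow> e w \<omega> \<in> B w)" for \<omega>
    proof -
      have "labels S e \<omega> w = e w \<omega>" if "length w = j" for w
        using that j by (auto simp: labels_def)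
      then show ?thesis by (auto simp: cylinder_def less_Suc_eq)
    qed
    then show ?thesis by (intro arg_cong[where f = "measure N"]) auto
  qed
  also have "\<dots> = (\<integral>\<omega>. indicator (?A \<inter> ?I) \<omega> \<partial>N)"
  proof -
    have "measure N X = (\<integral>\<omega>. indicator X \<omega> \<partial>N)" if "X \<in> sets N" for X
      using that by simp
    from this[OF sets.Int[OF AN I]] show ?thesis .
  qed
  also have "\<dots> = (\<integral>\<omega>\<in>?A. indicator ?I \<omega> \<partial>N)"
    unfolding set_lebesgue_integral_def by (simp only: indicator_inter_arith real_scaleR_def)
  also have "\<dots> = (\<integral>\<omega>\<in>?A. real_cond_exp N ?F (indicator ?I) \<omega> \<partial>N)"
  proof (rule F.real_cond_exp_intA[OF _ A])
    have "emeasure N X < \<infinity>" for X by (simp add: N.emeasure_eq_measure)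
    then show "integrable N (indicator ?I :: _ \<Rightarrow> real)" by (rule integrable_real_indicator[OF I])
  qed
  also have "\<dots> = (\<integral>\<omega>. indicator (cylinder j B) (labels S e \<omega>) * next_generation j B (labels S e \<omega>) \<partial>N)"
    unfolding set_lebesgue_integral_def
  proof (rule integral_cong_AE)
    note [measurable] = AN measurable_labels[OF lm] measurable_next_generation[OF B] sets_cylinder[OF B]
    show "(\<lambda>\<omega>. indicator ?A \<omega> *\<^sub>R real_cond_exp N ?F (indicator ?I) \<omega>) \<in> borel_measurable N"
      by measurable
    show "(\<lambda>\<omega>. indicator (cylinder j B) (labels S e \<omega>) * next_generation j B (labels S e \<omega>)) \<in> borel_measurable N"
      by measurable
    show "AE \<omega> in N. indicator ?A \<omega> *\<^sub>R real_cond_exp N ?F (indicator ?I) \<omega> =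
        indicator (cylinder j B) (labels S e \<omega>) * next_generation j B (labels S e \<omega>)"
      using ce AE_space by eventually_elim (auto simp: indicator_def)
  qed
  finally show ?thesis .
qed

lemma limiting_model_root_law:
  assumes "limiting_model N S e" "limiting_model N' S' e'" and A: "A \<in> sets borel"
  shows "measure N {\<omega> \<in> space N. S \<omega> \<in> A} = measure N' {\<omega> \<in> space N'. S' \<omega> \<in> A}"
proof -
  interpret N: prob_space N using assms by (simp add: limiting_model_def)
  interpret N': prob_space N' using assms by (simp add: limiting_model_def)
  have [measurable]: "S \<in> borel_measurable N" "S' \<in> borel_measurable N'"
    using assms by (auto simp: limiting_model_def)
  have "distr N borel S = distr N' borel S'"
  proof (rule cdf_unique)
    show "cdf (distr N borel S) = cdf (distr N' borel S')"
    proof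
      fix x
      have "measure N {\<omega> \<in> space N. S \<omega> \<le> x} = measure N' {\<omega> \<in> space N'. S' \<omega> \<le> x}"
        using assms by (simp add: limiting_model_def)
      then show "cdf (distr N borel S) x = cdf (distr N' borel S') x"
        by (simp add: cdf_def measure_distr vimage_def Int_def conj_commute)
    qed
  qed (auto intro: N.real_distribution_distr N'.real_distribution_distr)
  then have "measure (distr N borel S) A = measure (distr N' borel S') A" by simp
  then show ?thesis using A by (simp add: measure_distr vimage_def Int_def conj_commute)
qed

text \<open>Induction over the generations: the law of the first \<open>j\<close> generations determines the probability
  of a cylinder with one more generation, because the conditional law of the next generation is a
  fixed function of the labels before it.\<close>

theorem limiting_model_unique:
  assumes lm: "limiting_model N S e" and lm': "limiting_model N' S' e'"
  shows "distr N tree_borel (labels S e) = distr N' tree_borel (labels S' e')" (is "?P = ?Q")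
proof -
  interpret N: prob_space N using lm by (simp add: limiting_model_def)
  interpret N': prob_space N' using lm' by (simp add: limiting_model_def)
  note m = measurable_labels[OF lm] and m' = measurable_labels[OF lm']
  have P: "prob_space ?P" and Q: "prob_space ?Q"
    using m m' by (auto intro: N.prob_space_distr N'.prob_space_distr)
  have P_eq: "emeasure ?P A = ennreal (measure N {\<omega> \<in> space N. labels S e \<omega> \<in> A})"
    and Q_eq: "emeasure ?Q A = ennreal (measure N' {\<omega> \<in> space N'. labels S' e' \<omega> \<in> A})"
    if "A \<in> sets tree_borel" for A
    using that m m' by (simp_all add: emeasure_distr N.emeasure_eq_measure N'.emeasure_eq_measure
        vimage_def Int_def conj_commute)
  have "emeasure ?P (cylinder k B) = emeasure ?Q (cylinder k B)" if B: "\<And>w. B w \<in> sets borel" for k B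
    using B
  proof (induction k arbitrary: B)
    case 0
    then show ?case
      using prob_space.emeasure_space_1[OF P] prob_space.emeasure_space_1[OF Q] by (simp add: cylinder_0)
  next
    case (Suc j)
    show ?case
    proof (cases "j = 0")
      case True
      have "labels S e \<omega> \<in> cylinder (Suc 0) B \<longleftrightarrow> S \<omega> \<in> B []"
        "labels S' e' \<omega>' \<in> cylinder (Suc 0) B \<longleftrightarrow> S' \<omega>' \<in> B []" for \<omega> \<omega>'
        by (simp_all add: cylinder_def labels_def)
      then show ?thesis
        using limiting_model_root_law[OF lm lm' Suc.prems] True
        by (simp add: P_eq Q_eq sets_cylinder Suc.prems)
    next
      case False
      then have j: "1 \<le> j" by simp
      let ?H = "\<lambda>y. indicator (cylinder j B) y * next_generation j B y"
      note [measurable] = m m' measurable_next_generation[OF Suc.prems] sets_cylinder[OF Suc.prems]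
      have trunc: "?H (truncate j y) = ?H y" for y
        using truncate_in_cylinder_iff[of j y j B] j
        by (simp add: next_generation_truncate indicator_def cylinder_def)
      have "measure N {\<omega> \<in> space N. labels S e \<omega> \<in> cylinder (Suc j) B} = (\<integral>\<omega>. ?H (labels S e \<omega>) \<partial>N)"
        by (rule labels_next_generation[OF lm j Suc.prems])
      also have "\<dots> = (\<integral>y. ?H y \<partial>?P)"
        by (rule integral_distr[symmetric]) measurable
      also have "\<dots> = (\<integral>y. ?H (truncate j y) \<partial>?P)"
        by (simp only: trunc)
      also have "\<dots> = (\<integral>y. ?H y \<partial>distr ?P tree_borel (truncate j))"
        by (rule integral_distr[symmetric]) measurable
      also have "distr ?P tree_borel (truncate j) = distr ?Q tree_borel (truncate j)"
        by (rule truncated_law_eq[OF P _ Q]) (simp_all add: Suc.IH)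
      also have "(\<integral>y. ?H y \<partial>distr ?Q tree_borel (truncate j)) = (\<integral>y. ?H (truncate j y) \<partial>?Q)"
        by (rule integral_distr) measurable
      also have "\<dots> = (\<integral>y. ?H y \<partial>?Q)"
        by (simp only: trunc)
      also have "\<dots> = (\<integral>\<omega>. ?H (labels S' e' \<omega>) \<partial>N')"
        by (rule integral_distr) measurable
      also have "\<dots> = measure N' {\<omega> \<in> space N'. labels S' e' \<omega> \<in> cylinder (Suc j) B}"
        by (rule labels_next_generation[OF lm' j Suc.prems, symmetric])
      finally show ?thesis by (simp add: P_eq Q_eq sets_cylinder Suc.prems)
    qed
  qed
  then show ?thesis
    by (intro measure_eqI_cylinders P) simp_all
qed

lemma limiting_model_split:
  assumes lm: "limiting_model N S e" and A [measurable]: "A0 \<in> sets tree_borel" "A1 \<in> sets tree_borel"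
  shows "measure N {\<omega> \<in> space N. S \<omega> \<le> \<Delta> \<and> (\<lambda>w. e (False # w) \<omega>) \<in> A0 \<and> (\<lambda>w. e (True # w) \<omega>) \<in> A1} =
    (\<integral>\<delta>. logistic_density \<delta> * (indicator {..\<Delta>} \<delta> * (limit_prob \<delta> A0 * limit_prob \<delta> A1)) \<partial>lborel)"
proof -
  let ?E = "split_event {..\<Delta>} A0 A1"
  have iff: "labels S e \<omega> \<in> ?E \<longleftrightarrow> S \<omega> \<le> \<Delta> \<and> (\<lambda>w. e (False # w) \<omega>) \<in> A0 \<and> (\<lambda>w. e (True # w) \<omega>) \<in> A1"
    for S :: "'x \<Rightarrow> real" and e \<omega>
    by (simp add: split_event_def subtree_def labels_def[abs_def])
  have law: "measure N {\<omega> \<in> space N. labels S e \<omega> \<in> ?E} = measure (distr N tree_borel (labels S e)) ?E"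
    if "limiting_model N S e" for N :: "'x measure" and S e
    using measurable_labels[OF that] by (simp add: measure_distr vimage_def Int_def conj_commute)
  have "measure N {\<omega> \<in> space N. labels S e \<omega> \<in> ?E} = measure quantile_law {u \<in> space quantile_law.
      labels (\<lambda>u. quantile_time u []) (\<lambda>w u. q_quantile (quantile_time u (butlast w)) (u w)) u \<in> ?E}"
    unfolding law[OF lm] law[OF limiting_model_exists] limiting_model_unique[OF lm limiting_model_exists] ..
  then show ?thesis
    unfolding iff using quantile_model_split[OF A, of \<Delta>] by (simp add: space_PiM)
qed

section \<open>The conditioned tree as a quotient of weights\<close>

text \<open>This quotient carries one factor \<open>s\<close> more in numerator and denominator than the quotient in
  \<open>P_hat\<close>, which uses the exponent \<open>n(h) - 1\<close>; the two agree for \<open>s > 0\<close>.\<close>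

definition conditioned :: "real \<Rightarrow> real \<Rightarrow> (vertex \<Rightarrow> real) set \<Rightarrow> real" where
  "conditioned s h A = weighted s h A / pgf s h"

text \<open>The cases \<open>s = 1\<close> and \<open>s = 0\<close> of \<open>weighted_UNIV\<close>: the total mass 1 excludes infinite
  populations, the mass 0 of the weight \<open>0 ^ n\<close> excludes extinction.\<close>

lemma AE_alive:
  assumes h: "0 \<le> h"
  shows "AE x in wait_law. finite (alive x h) \<and> alive x h \<noteq> {}"
proof -
  note UNIV = UNIV_in_tree_borel
  have int: "integrable wait_law (\<lambda>x. pgf_weight s x h)" if "0 \<le> s" "s \<le> 1" for s
    using integrable_weighted[OF UNIV that] by simp
  have pgf: "(\<integral>x. pgf_weight s x h \<partial>wait_law) = pgf s h" if "0 \<le> s" "s \<le> 1" for s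
    using weighted_UNIV[OF that h] by (simp add: weighted_def)
  have "(\<integral>x. 1 - pgf_weight 1 x h \<partial>wait_law) = 0"
    by (subst Bochner_Integration.integral_diff) (auto simp: int pgf pgf_def)
  then have "AE x in wait_law. 1 - pgf_weight 1 x h = 0"
    by (subst (asm) integral_nonneg_eq_0_iff_AE) (auto intro!: int pgf_weight_bounds)
  moreover have "(\<integral>x. pgf_weight 0 x h \<partial>wait_law) = 0"
    by (simp add: pgf pgf_def)
  then have "AE x in wait_law. pgf_weight 0 x h = 0"
    by (subst (asm) integral_nonneg_eq_0_iff_AE) (auto intro!: int pgf_weight_bounds)
  ultimately show ?thesis
    by eventually_elim (auto simp: pgf_weight_def num_alive_def split: if_splits)
qed

lemma integral_weight_pred:
  assumes s: "0 < s" and h: "0 \<le> h" and [measurable]: "A \<in> sets tree_borel"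
  shows "(\<integral>x. indicator A x * s ^ (num_alive x h - 1) \<partial>wait_law) = weighted s h A / s"
proof -
  have "(\<integral>x. indicator A x * s ^ (num_alive x h - 1) \<partial>wait_law) =
      (\<integral>x. indicator A x * pgf_weight s x h / s \<partial>wait_law)"
  proof (rule integral_cong_AE)
    have "(\<lambda>x. s ^ (num_alive x h - 1)) \<in> borel_measurable tree_borel"
      by (rule measurable_compose[OF measurable_num_alive(2)]) simp_all
    then show "(\<lambda>x. indicator A x * s ^ (num_alive x h - 1)) \<in> borel_measurable wait_law"
      by measurable
    show "AE x in wait_law. indicator A x * s ^ (num_alive x h - 1) = indicator A x * pgf_weight s x h / s"
      using AE_alive[OF h]
    proof eventually_elim
      case (elim x)
      then have "num_alive x h \<noteq> 0" by (simp add: num_alive_def)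
      then obtain n where "num_alive x h = Suc n" using not0_implies_Suc by blast
      then show ?case using elim s by (simp add: pgf_weight_def)
    qed
  qed measurable
  then show ?thesis by (simp add: weighted_def)
qed

lemma branching_tree_law:
  assumes "branching_tree M e"
  shows "(\<lambda>\<omega> w. e w \<omega>) \<in> measurable M tree_borel"
    "distr M tree_borel (\<lambda>\<omega> w. e w \<omega>) = wait_law"
proof -
  interpret prob_space M using assms by (simp add: branching_tree_def)
  have d: "distributed M lborel (e w) (exponential_density 1)" for w
    using assms by (simp add: branching_tree_def)
  have rv [measurable]: "e w \<in> borel_measurable M" for w
    using distributed_measurable[OF d[of w]] by simp
  show "(\<lambda>\<omega> w. e w \<omega>) \<in> measurable M tree_borel"
    by (rule measurable_into_tree_borel) measurable
  have "distr M borel (e w) = expo" for w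
  proof -
    have "distr M borel (e w) = distr M lborel (e w)" by (rule distr_cong) simp_all
    then show ?thesis unfolding expo_def using distributed_distr_eq_density[OF d] by simp
  qed
  moreover have "distr M tree_borel (\<lambda>\<omega>. \<lambda>w\<in>UNIV. e w \<omega>) = (\<Pi>\<^sub>M w\<in>UNIV. distr M borel (e w))"
    using assms by (subst indep_vars_iff_distr_eq_PiM[symmetric]) (auto simp: branching_tree_def)
  ultimately show "distr M tree_borel (\<lambda>\<omega> w. e w \<omega>) = wait_law"
    by (simp add: iid_tree_def restrict_UNIV)
qed

lemma P_hat_eq_conditioned:
  assumes bt: "branching_tree M e" and s: "0 < sig l \<epsilon>" "sig l \<epsilon> \<le> 1" and h: "0 \<le> h"
    and A [measurable]: "A \<in> sets tree_borel"
  shows "P_hat M e \<epsilon> l h {\<omega> \<in> space M. (\<lambda>w. e w \<omega>) \<in> A} = conditioned (sig l \<epsilon>) h A"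
proof -
  let ?s = "sig l \<epsilon>"
  note [measurable] = branching_tree_law(1)[OF bt]
  note UNIV = UNIV_in_tree_borel
  have pull: "(\<integral>\<omega>. indicator {\<omega> \<in> space M. (\<lambda>w. e w \<omega>) \<in> B} \<omega> * ?s ^ (num_alive (\<lambda>w. e w \<omega>) h - 1) \<partial>M) =
      weighted ?s h B / ?s" if [measurable]: "B \<in> sets tree_borel" for B
  proof -
    have [measurable]: "(\<lambda>x. ?s ^ (num_alive x h - 1)) \<in> borel_measurable tree_borel"
      by (rule measurable_compose[OF measurable_num_alive(2)]) simp_all
    have "(\<integral>\<omega>. indicator {\<omega> \<in> space M. (\<lambda>w. e w \<omega>) \<in> B} \<omega> * ?s ^ (num_alive (\<lambda>w. e w \<omega>) h - 1) \<partial>M) =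
      (\<integral>\<omega>. indicator B (\<lambda>w. e w \<omega>) * ?s ^ (num_alive (\<lambda>w. e w \<omega>) h - 1) \<partial>M)"
      by (rule Bochner_Integration.integral_cong) (auto simp: indicator_def)
    also have "\<dots> = (\<integral>x. indicator B x * ?s ^ (num_alive x h - 1) \<partial>wait_law)"
      unfolding branching_tree_law(2)[OF bt, symmetric] by (rule integral_distr[symmetric]) measurable
    also have "\<dots> = weighted ?s h B / ?s"
      by (rule integral_weight_pred[OF s(1) h that])
    finally show ?thesis .
  qed
  have "v_sigma M e ?s h =
      (\<integral>\<omega>. indicator {\<omega> \<in> space M. (\<lambda>w. e w \<omega>) \<in> UNIV} \<omega> * ?s ^ (num_alive (\<lambda>w. e w \<omega>) h - 1) \<partial>M)"
    unfolding v_sigma_def by (rule Bochner_Integration.integral_cong) auto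
  then have "v_sigma M e ?s h = pgf ?s h / ?s"
    using pull[OF UNIV] weighted_UNIV[of ?s h] s h by simp
  then show ?thesis
    unfolding P_hat_def conditioned_def using pull[OF A] s by simp
qed

lemma pgf_pos: "0 < s \<Longrightarrow> s \<le> 1 \<Longrightarrow> 0 < pgf s h"
  using pgf_denominator_pos[of s h] by (simp add: pgf_def)

text \<open>The last bound is the uniform absolute continuity that makes the passage from cylinders to
  arbitrary measurable sets possible.\<close>

lemma conditioned_bounds:
  assumes s: "0 < s" "s \<le> 1" and h: "0 \<le> h" and A: "A \<in> sets tree_borel"
  shows "0 \<le> conditioned s h A" "conditioned s h A \<le> 1"
    "conditioned s h A \<le> measure wait_law A / pgf s h"
proof -
  note UNIV = UNIV_in_tree_borel
  have s': "0 \<le> s" using s by simp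
  note pos = pgf_pos[OF s, of h]
  show "0 \<le> conditioned s h A" "conditioned s h A \<le> measure wait_law A / pgf s h"
    unfolding conditioned_def using pos weighted_bounds[OF A s' s(2), of h]
    by (auto intro!: divide_right_mono)
  have "weighted s h A \<le> weighted s h UNIV"
    unfolding weighted_def using pgf_weight_bounds[OF s' s(2)]
    by (intro integral_mono integrable_weighted A UNIV s' s) (auto simp: indicator_def)
  then show "conditioned s h A \<le> 1"
    unfolding conditioned_def using weighted_UNIV[OF s' s(2) h] pos by simp
qed

lemma conditioned_UNIV: "0 < s \<Longrightarrow> s \<le> 1 \<Longrightarrow> 0 \<le> h \<Longrightarrow> conditioned s h UNIV = 1"
  using pgf_pos[of s h] by (simp add: conditioned_def weighted_UNIV)

lemma weighted_eq_measure:
  assumes A [measurable]: "A \<in> sets tree_borel" and s: "0 \<le> s" "s \<le> 1"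
  shows "weighted s h A = measure (density wait_law (\<lambda>x. pgf_weight s x h)) A"
proof -
  have "measure (density wait_law (\<lambda>x. pgf_weight s x h)) A =
      (\<integral>x. indicator A x \<partial>density wait_law (\<lambda>x. pgf_weight s x h))"
    by simp
  also have "\<dots> = (\<integral>x. pgf_weight s x h *\<^sub>R indicator A x \<partial>wait_law)"
    using pgf_weight_bounds[OF s] by (intro integral_density) auto
  finally show ?thesis by (simp add: weighted_def mult.commute)
qed

lemma finite_measure_weight:
  assumes s: "0 \<le> s" "s \<le> 1"
  shows "finite_measure (density wait_law (\<lambda>x. pgf_weight s x h))"
proof (rule finite_measureI)
  have "emeasure (density wait_law (\<lambda>x. pgf_weight s x h)) UNIV =
      (\<integral>\<^sup>+x. ennreal (pgf_weight s x h) \<partial>wait_law)"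
    using sets.top[of tree_borel] by (subst emeasure_density) auto
  also have "\<dots> \<le> (\<integral>\<^sup>+x. 1 \<partial>wait_law)"
    using pgf_weight_bounds[OF s] by (intro nn_integral_mono) (simp add: ennreal_le_1)
  also have "\<dots> = 1" using expo.T.emeasure_space_1 by simp
  finally show "emeasure (density wait_law (\<lambda>x. pgf_weight s x h))
      (space (density wait_law (\<lambda>x. pgf_weight s x h))) \<noteq> \<infinity>"
    by (auto simp: top_unique)
qed

lemma conditioned_sums:
  assumes A: "\<And>i. A i \<in> sets tree_borel" "disjoint_family A" and s: "0 \<le> s" "s \<le> 1"
  shows "(\<lambda>i. conditioned s h (A i)) sums conditioned s h (\<Union>i. A i)"
proof -
  interpret finite_measure "density wait_law (\<lambda>x. pgf_weight s x h)"
    by (rule finite_measure_weight[OF s])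
  have "(\<lambda>i. weighted s h (A i)) sums weighted s h (\<Union>i. A i)"
    using finite_measure_UNION[of A] A s by (subst (1 2) weighted_eq_measure) auto
  then show ?thesis unfolding conditioned_def by (rule sums_divide)
qed

lemma conditioned_compl:
  assumes A: "A \<in> sets tree_borel" and s: "0 < s" "s \<le> 1" and h: "0 \<le> h"
  shows "conditioned s h (UNIV - A) = 1 - conditioned s h A"
proof -
  have s': "0 \<le> s" using s by simp
  note UNIV = UNIV_in_tree_borel
  have "weighted s h (UNIV - A) = (\<integral>x. indicator UNIV x * pgf_weight s x h - indicator A x * pgf_weight s x h \<partial>wait_law)"
    unfolding weighted_def by (intro Bochner_Integration.integral_cong) (auto simp: indicator_def)
  also have "\<dots> = weighted s h UNIV - weighted s h A"
    unfolding weighted_def by (intro Bochner_Integration.integral_diff integrable_weighted A UNIV s' s)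
  finally show ?thesis
    using pgf_pos[OF s, of h] by (simp add: conditioned_def weighted_UNIV[OF s' s(2) h] diff_divide_distrib)
qed

lemma conditioned_split_event:
  assumes s: "0 < s" "s \<le> 1" and h: "0 \<le> h"
    and A: "R \<in> sets borel" "A0 \<in> sets tree_borel" "A1 \<in> sets tree_borel"
  shows "conditioned s h (split_event R A0 A1) = (\<integral>r. indicator R r *
    (if r \<le> h then (pgf s (h - r))\<^sup>2 / pgf s h * (conditioned s (h - r) A0 * conditioned s (h - r) A1)
     else s / pgf s h * (measure wait_law A0 * measure wait_law A1)) \<partial>expo)"
proof -
  have s': "0 \<le> s" using s by simp
  have "conditioned s h (split_event R A0 A1) = (\<integral>r. (indicator R r *
    (if r \<le> h then weighted s (h - r) A0 * weighted s (h - r) A1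
     else s * measure wait_law A0 * measure wait_law A1)) / pgf s h \<partial>expo)"
    unfolding conditioned_def by (subst weighted_split_event[OF s' s(2) h A]) simp
  also have "\<dots> = (\<integral>r. indicator R r *
    (if r \<le> h then (pgf s (h - r))\<^sup>2 / pgf s h * (conditioned s (h - r) A0 * conditioned s (h - r) A1)
     else s / pgf s h * (measure wait_law A0 * measure wait_law A1)) \<partial>expo)"
  proof (rule Bochner_Integration.integral_cong[OF refl])
    fix r
    show "(indicator R r *
    (if r \<le> h then weighted s (h - r) A0 * weighted s (h - r) A1
     else s * measure wait_law A0 * measure wait_law A1)) / pgf s h = indicator R r *
    (if r \<le> h then (pgf s (h - r))\<^sup>2 / pgf s h * (conditioned s (h - r) A0 * conditioned s (h - r) A1)
     else s / pgf s h * (measure wait_law A0 * measure wait_law A1))"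
      using pgf_pos[OF s, of "h - r"] by (simp add: conditioned_def power2_eq_square)
  qed
  finally show ?thesis .
qed

lemma conditioned_measurable [measurable (raw)]:
  assumes [measurable]: "A \<in> sets tree_borel" "f \<in> borel_measurable M"
  shows "(\<lambda>x. conditioned s (f x) A) \<in> borel_measurable M"
  unfolding conditioned_def by measurable

section \<open>The scaling limit of a subtree\<close>

text \<open>The parameters enter only through these asymptotics; \<open>a\<close> stands for \<open>\<lambda> \<epsilon>\<^sup>2\<close>.\<close>

locale scaling =
  fixes \<sigma> a :: "real \<Rightarrow> real"
  assumes a_pos: "\<forall>\<^sub>F t in at_top. 0 < a t"
    and \<sigma>_bounds: "\<forall>\<^sub>F t in at_top. 0 < \<sigma> t \<and> \<sigma> t \<le> 1"
    and a_tendsto: "(a \<longlongrightarrow> 0) at_top"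
    and \<sigma>_tendsto: "((\<lambda>t. (1 - \<sigma> t) / a t) \<longlongrightarrow> 1) at_top"
begin

text \<open>The remaining observation time at which a subtree looks like the limiting model started at \<open>T\<close>.\<close>

definition height :: "real \<Rightarrow> real \<Rightarrow> real" where
  "height t T = - ln (a t) - T"

lemma height_diff: "height t T - r = height t (T + r)"
  by (simp add: height_def)

lemma height_at_top: "filterlim (\<lambda>t. height t T) at_top at_top"
proof -
  have "filterlim a (at_right 0) at_top"
    using a_tendsto a_pos by (simp add: filterlim_at eventually_conj_iff)
      (auto elim: eventually_mono)
  then have "filterlim (\<lambda>t. ln (a t)) at_bot at_top"
    by (rule filterlim_compose[OF ln_at_0])
  then have "filterlim (\<lambda>t. - T + - ln (a t)) at_top at_top"
    by (intro filterlim_tendsto_add_at_top[OF tendsto_const]) (simp add: filterlim_uminus_at_top)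
  moreover have "(\<lambda>t. - T + - ln (a t)) = (\<lambda>t. height t T)" by (auto simp: height_def)
  ultimately show ?thesis by simp
qed

lemma eventually_height: "\<forall>\<^sub>F t in at_top. c \<le> height t T"
  using height_at_top[of T] by (simp add: filterlim_at_top)

lemma \<sigma>_to_1: "(\<sigma> \<longlongrightarrow> 1) at_top"
proof -
  have "((\<lambda>t. 1 - a t * ((1 - \<sigma> t) / a t)) \<longlongrightarrow> 1 - 0 * 1) at_top"
    by (intro tendsto_intros a_tendsto \<sigma>_tendsto)
  then have "((\<lambda>t. 1 - a t * ((1 - \<sigma> t) / a t)) \<longlongrightarrow> 1) at_top" by simp
  then show ?thesis
    by (rule Lim_transform_eventually) (use a_pos in \<open>auto elim: eventually_mono\<close>)
qed

lemma pgf_height: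
  assumes "0 < a t"
  shows "pgf (\<sigma> t) (height t T) = \<sigma> t * exp T / ((1 - \<sigma> t) / a t + \<sigma> t * exp T)"
proof -
  have "exp (- height t T) = a t * exp T"
    using assms by (simp add: height_def exp_add)
  then have "pgf (\<sigma> t) (height t T) = (a t * (\<sigma> t * exp T)) / (a t * ((1 - \<sigma> t) / a t + \<sigma> t * exp T))"
    using assms by (simp add: pgf_def distrib_left mult_ac)
  then show ?thesis using assms by simp
qed

lemma pgf_height_tendsto: "((\<lambda>t. pgf (\<sigma> t) (height t T)) \<longlongrightarrow> 1 / (1 + exp (- T))) at_top"
proof -
  have "1 + 1 * exp T \<noteq> 0" by (metis add_pos_pos exp_gt_zero less_irrefl mult_1 zero_less_one)
  then have "((\<lambda>t. \<sigma> t * exp T / ((1 - \<sigma> t) / a t + \<sigma> t * exp T)) \<longlongrightarrow> 1 * exp T / (1 + 1 * exp T)) at_top"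
    by (intro tendsto_intros \<sigma>_to_1 \<sigma>_tendsto)
  also have "1 * exp T / (1 + 1 * exp T) = 1 / (1 + exp (- T))"
    by (simp add: exp_minus field_simps add_pos_pos)
  finally show ?thesis
    by (rule Lim_transform_eventually) (use a_pos in \<open>auto simp: pgf_height elim: eventually_mono\<close>)
qed

definition converges :: "real \<Rightarrow> (vertex \<Rightarrow> real) set \<Rightarrow> bool" where
  "converges T A \<longleftrightarrow> ((\<lambda>t. conditioned (\<sigma> t) (height t T) A) \<longlongrightarrow> limit_prob T A) at_top"

definition pgf_bound :: "real \<Rightarrow> real" where
  "pgf_bound T = 2 * (1 + exp (- T))"

lemma eventually_inverse_pgf_le: "\<forall>\<^sub>F t in at_top. 1 / pgf (\<sigma> t) (height t T) \<le> pgf_bound T"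
proof -
  have pos: "0 < 1 + exp (- T)" by (simp add: add_pos_pos)
  have "((\<lambda>t. 1 / pgf (\<sigma> t) (height t T)) \<longlongrightarrow> 1 / (1 / (1 + exp (- T)))) at_top"
    using pos by (intro tendsto_intros pgf_height_tendsto) simp
  moreover have "1 / (1 / (1 + exp (- T))) < pgf_bound T" using pos by (simp add: pgf_bound_def)
  ultimately have "\<forall>\<^sub>F t in at_top. 1 / pgf (\<sigma> t) (height t T) < pgf_bound T"
    by (rule order_tendstoD)
  then show ?thesis by (rule eventually_mono) simp
qed

lemma converges_UNIV: "converges T UNIV"
proof -
  have "\<forall>\<^sub>F t in at_top. 1 = conditioned (\<sigma> t) (height t T) UNIV"
    using \<sigma>_bounds eventually_height[of 0 T] by eventually_elim (simp add: conditioned_UNIV)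
  moreover have "limit_prob T UNIV = 1" by (simp add: limit_prob_def)
  ultimately show ?thesis
    unfolding converges_def by (simp add: Lim_transform_eventually[OF tendsto_const])
qed

text \<open>The integrand over the root label \<open>r\<close> converges pointwise, because a subtree born at \<open>r\<close> has the
  remaining time \<open>height t (T + r)\<close>, and it is dominated by \<open>1 / pgf\<close>, which is eventually bounded.\<close>

lemma converges_split_event:
  assumes R [measurable]: "R \<in> sets borel" and A [measurable]: "A0 \<in> sets tree_borel" "A1 \<in> sets tree_borel"
    and conv: "\<And>T. converges T A0" "\<And>T. converges T A1"
  shows "converges T (split_event R A0 A1)"
proof -
  define f where "f t r = indicator R r *
    (if r \<le> height t T then (pgf (\<sigma> t) (height t T - r))\<^sup>2 / pgf (\<sigma> t) (height t T) *
        (conditioned (\<sigma> t) (height t T - r) A0 * conditioned (\<sigma> t) (height t T - r) A1)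
     else \<sigma> t / pgf (\<sigma> t) (height t T) * (measure wait_law A0 * measure wait_law A1))" for t r
  let ?g = "\<lambda>r. limit_ratio T r * (indicator R r * (limit_prob (T + r) A0 * limit_prob (T + r) A1))"
  have "((\<lambda>t. \<integral>r. f t r \<partial>expo) \<longlongrightarrow> (\<integral>r. ?g r \<partial>expo)) at_top"
  proof (rule integral_dominated_convergence_at_top[where w = "\<lambda>_. pgf_bound T"])
    show "?g \<in> borel_measurable expo" by measurable
    show "f t \<in> borel_measurable expo" for t unfolding f_def by measurable
    show "integrable expo (\<lambda>_. pgf_bound T)" by simp
    show "AE r in expo. ((\<lambda>t. f t r) \<longlongrightarrow> ?g r) at_top"
    proof (rule AE_I2)
      fix r
      have nz: "1 / (1 + exp (- T)) \<noteq> 0"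
        by (metis add_pos_pos divide_eq_0_iff exp_gt_zero less_irrefl zero_less_one)
      have "((\<lambda>t. indicator R r * ((pgf (\<sigma> t) (height t (T + r)))\<^sup>2 / pgf (\<sigma> t) (height t T) *
          (conditioned (\<sigma> t) (height t (T + r)) A0 * conditioned (\<sigma> t) (height t (T + r)) A1))) \<longlongrightarrow>
          indicator R r * ((1 / (1 + exp (- (T + r))))\<^sup>2 / (1 / (1 + exp (- T))) *
          (limit_prob (T + r) A0 * limit_prob (T + r) A1))) at_top"
        using conv nz unfolding converges_def by (intro tendsto_intros pgf_height_tendsto) auto
      also have "indicator R r * ((1 / (1 + exp (- (T + r))))\<^sup>2 / (1 / (1 + exp (- T))) *
          (limit_prob (T + r) A0 * limit_prob (T + r) A1)) = ?g r"
      proof -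
        have "- (T + r) = - r - T" by simp
        then show ?thesis by (simp only: limit_ratio_def) (simp add: power_divide)
      qed
      finally show "((\<lambda>t. f t r) \<longlongrightarrow> ?g r) at_top"
      proof (rule Lim_transform_eventually)
        show "\<forall>\<^sub>F t in at_top. indicator R r * ((pgf (\<sigma> t) (height t (T + r)))\<^sup>2 / pgf (\<sigma> t) (height t T) *
          (conditioned (\<sigma> t) (height t (T + r)) A0 * conditioned (\<sigma> t) (height t (T + r)) A1)) = f t r"
          using eventually_height[of r T] by eventually_elim (simp add: f_def height_diff)
      qed
    qed
    show "\<forall>\<^sub>F t in at_top. AE r in expo. norm (f t r) \<le> pgf_bound T"
      using \<sigma>_bounds eventually_height[of 0 T] eventually_inverse_pgf_le[of T]
    proof eventually_elim
      case (elim t)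
      let ?p = "pgf (\<sigma> t) (height t T)"
      have p: "0 < ?p" using elim pgf_pos by blast
      have "\<bar>f t r\<bar> \<le> 1 / ?p" for r
      proof (cases "r \<le> height t T")
        case True
        then have h: "0 \<le> height t T - r" by simp
        have c: "0 \<le> conditioned (\<sigma> t) (height t T - r) B" "conditioned (\<sigma> t) (height t T - r) B \<le> 1"
          if "B \<in> sets tree_borel" for B
          using elim(1) h that by (auto intro!: conditioned_bounds)
        have q: "0 \<le> pgf (\<sigma> t) (height t T - r)" "pgf (\<sigma> t) (height t T - r) \<le> 1"
          using elim(1) h by (auto intro!: pgf_bounds)
        have "f t r = (indicator R r * ((pgf (\<sigma> t) (height t T - r))\<^sup>2 *
            (conditioned (\<sigma> t) (height t T - r) A0 * conditioned (\<sigma> t) (height t T - r) A1))) / ?p"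
          using True by (simp add: f_def)
        moreover have "indicator R r * ((pgf (\<sigma> t) (height t T - r))\<^sup>2 *
            (conditioned (\<sigma> t) (height t T - r) A0 * conditioned (\<sigma> t) (height t T - r) A1)) \<le> 1"
          using q c[OF A(1)] c[OF A(2)] by (intro mult_le_one) (auto simp: indicator_def power_le_one)
        ultimately show ?thesis
          using p q c[OF A(1)] c[OF A(2)] by (simp add: abs_mult divide_right_mono)
      next
        case False
        have "f t r = (indicator R r * (\<sigma> t * (measure wait_law A0 * measure wait_law A1))) / ?p"
          using False by (simp add: f_def)
        moreover have "indicator R r * (\<sigma> t * (measure wait_law A0 * measure wait_law A1)) \<le> 1"
          using elim(1) expo.T.prob_le_1 by (intro mult_le_one) (auto simp: indicator_def)
        ultimately show ?thesis
          using p elim(1) by (simp add: abs_mult divide_right_mono)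
      qed
      then show ?case using elim(3) by (intro AE_I2) (force intro: order_trans)
    qed
  qed
  then have "((\<lambda>t. \<integral>r. f t r \<partial>expo) \<longlongrightarrow> limit_prob T (split_event R A0 A1)) at_top"
    by (simp add: limit_prob_split_event)
  then show ?thesis unfolding converges_def
  proof (rule Lim_transform_eventually)
    show "\<forall>\<^sub>F t in at_top. (\<integral>r. f t r \<partial>expo) = conditioned (\<sigma> t) (height t T) (split_event R A0 A1)"
      using \<sigma>_bounds eventually_height[of 0 T]
      by eventually_elim (simp add: f_def conditioned_split_event)
  qed
qed

lemma converges_cylinder:
  assumes "\<And>w. B w \<in> sets borel"
  shows "converges T (cylinder k B)"
  using assms
proof (induction k arbitrary: B T)
  case 0
  then show ?case by (simp add: cylinder_0 converges_UNIV)
next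
  case (Suc k)
  have "cylinder (Suc k) B = split_event (B []) (cylinder k (\<lambda>w. B (False # w))) (cylinder k (\<lambda>w. B (True # w)))"
    by (simp add: cylinder_Suc split_event_def)
  then show ?case
    using Suc by (simp add: converges_split_event sets_cylinder)
qed

text \<open>Dynkin's lemma. The critical case is a countable disjoint union: the conditioned probabilities are
  dominated by a fixed multiple of the summable unconditioned ones, so Tannery's theorem applies.\<close>

lemma converges:
  assumes "A \<in> sets tree_borel"
  shows "converges T A"
proof -
  interpret L: prob_space "distr (iid_tree unif) tree_borel (limit_wait T)"
    by (rule unif.T.prob_space_distr) measurable
  have A: "A \<in> sigma_sets UNIV cylinders" using assms by (simp add: sets_tree_borel_cylinders)
  have "cylinders \<subseteq> Pow UNIV" by simp
  from Int_stable_cylinders this A show ?thesis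
  proof (induction rule: sigma_sets_induct_disjoint)
    case (basic A)
    then show ?case by (auto simp: cylinders_def converges_cylinder)
  next
    case empty
    then show ?case by (simp add: converges_def conditioned_def weighted_def limit_prob_def)
  next
    case (compl A)
    then have A: "A \<in> sets tree_borel" by (simp add: sets_tree_borel_cylinders)
    have "((\<lambda>t. 1 - conditioned (\<sigma> t) (height t T) A) \<longlongrightarrow> 1 - limit_prob T A) at_top"
      using compl(2) unfolding converges_def by (intro tendsto_intros)
    also have "1 - limit_prob T A = limit_prob T (UNIV - A)"
      using L.prob_compl[of A] A sets.compl_sets[OF A] by (simp add: limit_prob_eq_measure)
    finally show ?case unfolding converges_def
    proof (rule Lim_transform_eventually)
      show "\<forall>\<^sub>F t in at_top. 1 - conditioned (\<sigma> t) (height t T) A = conditioned (\<sigma> t) (height t T) (UNIV - A)"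
        using \<sigma>_bounds eventually_height[of 0 T] by eventually_elim (simp add: conditioned_compl A)
    qed
  next
    case (union A)
    then have A: "A i \<in> sets tree_borel" for i by (auto simp: sets_tree_borel_cylinders)
    have UA: "(\<Union>i. A i) \<in> sets tree_borel" using A by auto
    let ?c = "\<lambda>k t. conditioned (\<sigma> t) (height t T) (A k)"
    let ?M = "\<lambda>k. measure wait_law (A k) * pgf_bound T"
    have ev: "\<forall>\<^sub>F t in at_top. \<forall>k. norm (?c k t) \<le> ?M k"
      using \<sigma>_bounds eventually_height[of 0 T] eventually_inverse_pgf_le[of T]
    proof eventually_elim
      case (elim t)
      show ?case
      proof
        fix k
        have "measure wait_law (A k) * (1 / pgf (\<sigma> t) (height t T)) \<le> ?M k"
          using elim(3) by (intro mult_left_mono) auto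
        then show "norm (?c k t) \<le> ?M k"
          using conditioned_bounds[OF _ _ elim(2) A[of k], of "\<sigma> t"] elim(1) by simp
      qed
    qed
    have "((\<lambda>t. \<Sum>k. ?c k t) \<longlongrightarrow> (\<Sum>k. limit_prob T (A k))) at_top"
    proof (rule tannerys_theorem[THEN conjunct2, THEN conjunct2])
      show "((\<lambda>t. ?c k t) \<longlongrightarrow> limit_prob T (A k)) at_top" for k
        using union(3)[of k] by (simp add: converges_def)
      show "\<forall>\<^sub>F (k, t) in at_top \<times>\<^sub>F at_top. norm (?c k t) \<le> ?M k"
        unfolding eventually_prod_filter
        using ev by (intro exI[of _ "\<lambda>_. True"] exI[of _ "\<lambda>t. \<forall>k. norm (?c k t) \<le> ?M k"]) auto
      have "summable (\<lambda>k. measure wait_law (A k))"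
        using expo.T.finite_measure_UNION[of A] union(1) A by (auto intro: sums_summable)
      then show "summable ?M" by (rule summable_mult2)
    qed simp
    moreover have "(\<Sum>k. limit_prob T (A k)) = limit_prob T (\<Union>i. A i)"
      using L.finite_measure_UNION[of A] union(1) A UA
      by (simp add: limit_prob_eq_measure sums_unique[symmetric] image_subset_iff)
    moreover have "\<forall>\<^sub>F t in at_top. (\<Sum>k. ?c k t) = conditioned (\<sigma> t) (height t T) (\<Union>i. A i)"
      using \<sigma>_bounds
      by eventually_elim (intro sums_unique[symmetric] conditioned_sums A union(1); simp)
    ultimately show ?case
      unfolding converges_def by (auto intro: Lim_transform_eventually)
  qed
qed

end

section \<open>The first branching time\<close>

lemma integrable_logistic_density: "integrable lborel logistic_density"
proof -
  have "integrable lborel (\<lambda>x. logistic_density x * 1) \<longleftrightarrow> integrable quantile_law (\<lambda>_. 1 :: real)"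
    by (rule distributed_integrable[OF distributed_quantile_time_root])
      (simp_all add: logistic_density_nonneg)
  moreover have "integrable quantile_law (\<lambda>_. 1 :: real)" by simp
  ultimately show ?thesis by simp
qed

lemma logistic_density_eq: "logistic_density x = exp x / (1 + exp x)\<^sup>2"
proof -
  have "inverse b / (1 + inverse b)\<^sup>2 = b / (1 + b)\<^sup>2" if "0 < b" for b :: real
    using that by (simp add: field_simps power2_eq_square)
  from this[of "exp x"] show ?thesis
    by (simp add: logistic_density_def exp_minus)
qed

text \<open>Supplies the integrable majorant for the density of the first branching time.\<close>

lemma exp_le_logistic_density:
  assumes "x \<le> \<Delta>"
  shows "exp x \<le> (1 + exp \<Delta>)\<^sup>2 * logistic_density x"
proof -
  have "(1 + exp x)\<^sup>2 \<le> (1 + exp \<Delta>)\<^sup>2"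
    using assms by (intro power_mono) (auto simp: add_nonneg_nonneg)
  then have "exp x * (1 + exp x)\<^sup>2 \<le> (1 + exp \<Delta>)\<^sup>2 * exp x" by (simp add: mult.commute)
  moreover have "0 < (1 + exp x)\<^sup>2" by (intro zero_less_power add_pos_pos) simp_all
  ultimately show ?thesis by (simp add: logistic_density_eq pos_le_divide_eq)
qed

context scaling
begin

lemma eventually_pgf_height_le: "\<forall>\<^sub>F t in at_top. \<forall>T. pgf (\<sigma> t) (height t T) \<le> 2 * exp T"
proof -
  have "\<forall>\<^sub>F t in at_top. 1 / 2 < (1 - \<sigma> t) / a t"
    by (rule order_tendstoD(1)[OF \<sigma>_tendsto]) simp
  with a_pos \<sigma>_bounds show ?thesis
  proof eventually_elim
    case (elim t)
    have "\<sigma> t * exp T / ((1 - \<sigma> t) / a t + \<sigma> t * exp T) \<le> exp T / (1 / 2)" for T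
      using elim by (intro frac_le) (auto intro: add_increasing2)
    then show ?case using elim(1) by (simp add: pgf_height mult.commute)
  qed
qed

text \<open>The full observation time \<open>t\<close> is \<open>height t (- (t + ln (a t)))\<close>, so the model starts at
  \<open>- (t + ln (a t))\<close>, which tends to the distant past.\<close>

lemma pgf_initial_tendsto:
  assumes "filterlim (\<lambda>t. t + ln (a t)) at_top at_top"
  shows "((\<lambda>t. exp (- (t + ln (a t))) / pgf (\<sigma> t) t) \<longlongrightarrow> 1) at_top"
proof -
  let ?T = "\<lambda>t. t + ln (a t)"
  have "((\<lambda>t. exp (- ?T t)) \<longlongrightarrow> 0) at_top"
  proof (rule filterlim_compose[OF exp_at_bot])
    show "filterlim (\<lambda>t. - ?T t) at_bot at_top"
      unfolding filterlim_uminus_at_bot minus_minus by (rule assms)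
  qed
  then have "((\<lambda>t. ((1 - \<sigma> t) / a t + \<sigma> t * exp (- ?T t)) / \<sigma> t) \<longlongrightarrow> (1 + 1 * 0) / 1) at_top"
    by (intro tendsto_intros \<sigma>_to_1 \<sigma>_tendsto) simp_all
  then have "((\<lambda>t. ((1 - \<sigma> t) / a t + \<sigma> t * exp (- ?T t)) / \<sigma> t) \<longlongrightarrow> 1) at_top" by simp
  then show ?thesis
  proof (rule Lim_transform_eventually)
    show "\<forall>\<^sub>F t in at_top. ((1 - \<sigma> t) / a t + \<sigma> t * exp (- ?T t)) / \<sigma> t = exp (- ?T t) / pgf (\<sigma> t) t"
      using a_pos \<sigma>_bounds
    proof eventually_elim
      case (elim t)
      have "height t (- ?T t) = t" by (simp add: height_def)
      then show ?case
        using elim pgf_height[of t "- ?T t"] by (simp del: minus_add_distrib)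
    qed
  qed
qed

text \<open>The substitution \<open>r = t + ln (a t) + \<delta>\<close> for the first branching time turns the remaining time
  \<open>t - r\<close> into \<open>height t \<delta>\<close>. The integrand is then dominated by \<open>8 * exp \<delta>\<close> on \<open>\<delta> \<le> \<Delta>\<close>, since the
  exponential density contributes \<open>exp (- \<delta>)\<close>, each of the two subtrees a factor
  \<open>pgf \<le> 2 * exp \<delta>\<close>, and the remaining factor, which tends to 1, is at most 2.\<close>

lemma first_branching_converges:
  assumes T: "filterlim (\<lambda>t. t + ln (a t)) at_top at_top"
    and A [measurable]: "A0 \<in> sets tree_borel" "A1 \<in> sets tree_borel"
  shows "((\<lambda>t. conditioned (\<sigma> t) t (split_event {..\<Delta> + t + ln (a t)} A0 A1)) \<longlongrightarrow>
    (\<integral>\<delta>. logistic_density \<delta> * (indicator {..\<Delta>} \<delta> * (limit_prob \<delta> A0 * limit_prob \<delta> A1)) \<partial>lborel)) at_top"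
    (is "(_ \<longlongrightarrow> (\<integral>\<delta>. ?g \<delta> \<partial>lborel)) at_top")
proof -
  let ?T = "\<lambda>t. t + ln (a t)"
  let ?c = "\<lambda>t \<delta> A. conditioned (\<sigma> t) (height t \<delta>) A"
  \<comment> \<open>For large \<open>t\<close> every \<open>\<delta> \<le> \<Delta>\<close> leaves a nonnegative remaining time, so that the case of a root
    branching after \<open>t\<close> does not occur in \<open>f\<close>.\<close>
  define f where "f t \<delta> = indicator {..\<Delta>} \<delta> * (exponential_density 1 (?T t + \<delta>) *
    ((pgf (\<sigma> t) (height t \<delta>))\<^sup>2 / pgf (\<sigma> t) t * (?c t \<delta> A0 * ?c t \<delta> A1)))" for t \<delta>
  let ?w = "\<lambda>\<delta>. 8 * (1 + exp \<Delta>)\<^sup>2 * logistic_density \<delta>"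
  have t_ge: "\<forall>\<^sub>F t in at_top. 0 \<le> (t::real)" by (rule eventually_ge_at_top)
  note \<kappa> = pgf_initial_tendsto[OF T]
  have "((\<lambda>t. \<integral>\<delta>. f t \<delta> \<partial>lborel) \<longlongrightarrow> (\<integral>\<delta>. ?g \<delta> \<partial>lborel)) at_top"
  proof (rule integral_dominated_convergence_at_top[where w = ?w])
    show "?g \<in> borel_measurable lborel" by measurable
    show "f t \<in> borel_measurable lborel" for t unfolding f_def height_def by measurable
    show "integrable lborel ?w" by (intro integrable_mult_right integrable_logistic_density)
    show "AE \<delta> in lborel. ((\<lambda>t. f t \<delta>) \<longlongrightarrow> ?g \<delta>) at_top"
    proof (rule AE_I2)
      fix \<delta>
      have "((\<lambda>t. indicator {..\<Delta>} \<delta> * (exp (- \<delta>) * (exp (- ?T t) / pgf (\<sigma> t) t) *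
          ((pgf (\<sigma> t) (height t \<delta>))\<^sup>2 * (?c t \<delta> A0 * ?c t \<delta> A1)))) \<longlongrightarrow>
          indicator {..\<Delta>} \<delta> * (exp (- \<delta>) * 1 * ((1 / (1 + exp (- \<delta>)))\<^sup>2 * (limit_prob \<delta> A0 * limit_prob \<delta> A1)))) at_top"
        by (intro tendsto_intros pgf_height_tendsto \<kappa> converges[unfolded converges_def] A)
      also have "indicator {..\<Delta>} \<delta> * (exp (- \<delta>) * 1 * ((1 / (1 + exp (- \<delta>)))\<^sup>2 * (limit_prob \<delta> A0 * limit_prob \<delta> A1))) = ?g \<delta>"
        by (simp add: logistic_density_def power_divide)
      finally show "((\<lambda>t. f t \<delta>) \<longlongrightarrow> ?g \<delta>) at_top"
      proof (rule Lim_transform_eventually)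
        have "\<forall>\<^sub>F t in at_top. - \<delta> \<le> ?T t" using T by (simp add: filterlim_at_top)
        then show "\<forall>\<^sub>F t in at_top. indicator {..\<Delta>} \<delta> * (exp (- \<delta>) * (exp (- ?T t) / pgf (\<sigma> t) t) *
          ((pgf (\<sigma> t) (height t \<delta>))\<^sup>2 * (?c t \<delta> A0 * ?c t \<delta> A1))) = f t \<delta>"
        proof eventually_elim
          case (elim t)
          have "exponential_density 1 (?T t + \<delta>) = exp (- \<delta>) * exp (- ?T t)"
            using elim by (simp add: exponential_density_def exp_add[symmetric] del: minus_add_distrib)
          then show ?case by (simp add: f_def del: minus_add_distrib)
        qed
      qed
    qed
    have "\<forall>\<^sub>F t in at_top. exp (- ?T t) / pgf (\<sigma> t) t < 2"
      by (rule order_tendstoD(2)[OF \<kappa>]) simp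
    with \<sigma>_bounds eventually_height[of \<Delta> 0] eventually_pgf_height_le
    show "\<forall>\<^sub>F t in at_top. AE \<delta> in lborel. norm (f t \<delta>) \<le> ?w \<delta>"
    proof eventually_elim
      case (elim t)
      have p: "0 < pgf (\<sigma> t) t" using elim(1) pgf_pos by blast
      have "\<bar>f t \<delta>\<bar> \<le> ?w \<delta>" for \<delta>
      proof (cases "\<delta> \<le> \<Delta>")
        case True
        then have h: "0 \<le> height t \<delta>" using elim(2) by (simp add: height_def)
        have c: "0 \<le> ?c t \<delta> B" "?c t \<delta> B \<le> 1" if "B \<in> sets tree_borel" for B
          using elim(1) h that by (auto intro!: conditioned_bounds)
        have q: "0 \<le> pgf (\<sigma> t) (height t \<delta>)" using elim(1) h by (auto intro!: pgf_bounds)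
        have e: "exponential_density 1 (?T t + \<delta>) \<le> exp (- \<delta>) * exp (- ?T t)"
          by (auto simp: exponential_density_def exp_add[symmetric])
        have "\<bar>f t \<delta>\<bar> = exponential_density 1 (?T t + \<delta>) *
            ((pgf (\<sigma> t) (height t \<delta>))\<^sup>2 / pgf (\<sigma> t) t * (?c t \<delta> A0 * ?c t \<delta> A1))"
          using True p q c[OF A(1)] c[OF A(2)] by (simp add: f_def abs_mult exponential_density_nonneg)
        also have "\<dots> \<le> (exp (- \<delta>) * exp (- ?T t)) * ((2 * exp \<delta>)\<^sup>2 / pgf (\<sigma> t) t * 1)"
          using p q c[OF A(1)] c[OF A(2)] elim(3)
          by (intro mult_mono e divide_right_mono power_mono mult_le_one) (auto simp: exponential_density_nonneg)
        also have "\<dots> = 4 * exp \<delta> * (exp (- ?T t) / pgf (\<sigma> t) t)"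
        proof -
          have "exp (- \<delta>) * exp \<delta> = 1" by (simp add: exp_add[symmetric])
          then have "exp (- \<delta>) * (2 * exp \<delta>)\<^sup>2 = 4 * exp \<delta>" by (simp add: power2_eq_square)
          then show ?thesis by (simp add: mult_ac)
        qed
        also have "\<dots> \<le> 4 * exp \<delta> * 2"
          using elim(4) by (intro mult_left_mono) auto
        also have "\<dots> \<le> ?w \<delta>"
          using exp_le_logistic_density[OF True] by simp
        finally show ?thesis .
      qed (simp add: f_def logistic_density_nonneg)
      then show ?case by simp
    qed
  qed
  then show ?thesis
  proof (rule Lim_transform_eventually)
    show "\<forall>\<^sub>F t in at_top. (\<integral>\<delta>. f t \<delta> \<partial>lborel) =
        conditioned (\<sigma> t) t (split_event {..\<Delta> + t + ln (a t)} A0 A1)"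
      using \<sigma>_bounds eventually_height[of \<Delta> 0] t_ge
    proof eventually_elim
      case (elim t)
      define G where "G r = indicator {..\<Delta> + t + ln (a t)} r *
        (if r \<le> t then (pgf (\<sigma> t) (t - r))\<^sup>2 / pgf (\<sigma> t) t * (conditioned (\<sigma> t) (t - r) A0 * conditioned (\<sigma> t) (t - r) A1)
         else \<sigma> t / pgf (\<sigma> t) t * (measure wait_law A0 * measure wait_law A1))" for r
      have [measurable]: "G \<in> borel_measurable borel" unfolding G_def by measurable
      have "conditioned (\<sigma> t) t (split_event {..\<Delta> + t + ln (a t)} A0 A1) = (\<integral>r. G r \<partial>expo)"
        unfolding G_def by (rule conditioned_split_event) (use elim in simp_all)
      also have "\<dots> = (\<integral>r. exponential_density 1 r * G r \<partial>lborel)"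
        by (rule integral_expo) measurable
      also have "\<dots> = (\<integral>\<delta>. exponential_density 1 (?T t + \<delta>) * G (?T t + \<delta>) \<partial>lborel)"
        by (subst lborel_integral_real_affine[where c = 1 and t = "?T t"]) simp_all
      also have "\<dots> = (\<integral>\<delta>. f t \<delta> \<partial>lborel)"
      proof (rule Bochner_Integration.integral_cong[OF refl])
        fix \<delta>
        show "exponential_density 1 (?T t + \<delta>) * G (?T t + \<delta>) = f t \<delta>"
        proof (cases "\<delta> \<le> \<Delta>")
          case True
          then have "?T t + \<delta> \<le> t" "?T t + \<delta> \<le> \<Delta> + t + ln (a t)" "t - (?T t + \<delta>) = height t \<delta>"
            using elim(2) by (simp_all add: height_def)
          then show ?thesis using True unfolding f_def G_def by simp
        qed (simp add: f_def G_def)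
      qed
      finally show ?case by simp
    qed
  qed
qed

end

section \<open>The sech weights\<close>

text \<open>By the half-angle formula \<open>cosh y - 1 = 2 * (sinh (y / 2))\<^sup>2\<close> this reduces to the derivative of
  \<open>sinh\<close> at 0.\<close>

lemma sech_quadratic: "((\<lambda>y. (1 - sech y) / (y\<^sup>2 / 2)) \<longlongrightarrow> 1) (at_right 0)"
proof -
  have "((\<lambda>z::real. (sinh z - sinh 0) / (z - 0)) \<longlongrightarrow> cosh 0) (at 0)"
    using has_field_derivative_sinh[OF DERIV_ident, of 0 UNIV] by (simp add: has_field_derivative_iff)
  then have "((\<lambda>z::real. sinh z / z) \<longlongrightarrow> 1) (at_right 0)"
    by (simp add: filterlim_at_split)
  moreover have "filterlim (\<lambda>y::real. y / 2) (at_right 0) (at_right 0)"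
  proof -
    have "((\<lambda>y::real. y / 2) \<longlongrightarrow> 0 / 2) (at_right 0)" by (intro tendsto_intros) simp
    then show ?thesis
      by (auto simp: filterlim_at eventually_at_right_field intro: exI[of _ 1])
  qed
  ultimately have *: "((\<lambda>y::real. sinh (y / 2) / (y / 2)) \<longlongrightarrow> 1) (at_right 0)"
    by (rule filterlim_compose)
  have "(cosh \<longlongrightarrow> cosh (0 :: real)) (at_right 0)"
    by (rule tendsto_cosh[OF tendsto_ident_at])
  then have "((\<lambda>y::real. (sinh (y / 2) / (y / 2))\<^sup>2 / cosh y) \<longlongrightarrow> 1\<^sup>2 / cosh 0) (at_right 0)"
    by (intro tendsto_intros *) simp_all
  moreover have "(sinh (y / 2) / (y / 2))\<^sup>2 / cosh y = (1 - sech y) / (y\<^sup>2 / 2)" for y :: real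
  proof -
    have "cosh y = (cosh (y / 2))\<^sup>2 + (sinh (y / 2))\<^sup>2" using cosh_double[of "y / 2"] by simp
    then have "cosh y - 1 = 2 * (sinh (y / 2))\<^sup>2" by (simp add: cosh_square_eq)
    moreover have "1 - sech y = (cosh y - 1) / cosh y" by (simp add: sech_def diff_divide_distrib)
    ultimately show ?thesis by (simp add: power_divide mult.commute)
  qed
  ultimately show ?thesis by simp
qed

lemma sech_bounds: "0 < sech x" "sech x \<le> 1"
  using cosh_real_ge_1[of x] by (simp_all add: sech_def)

lemma scaling_sig:
  assumes \<epsilon>: "0 < \<epsilon>" and pos: "\<And>t. 0 < t \<Longrightarrow> 0 < lam t" and lim: "(lam \<longlongrightarrow> 0) at_top"
  shows "scaling (\<lambda>t. sig (lam t) \<epsilon>) (\<lambda>t. lam t * \<epsilon>\<^sup>2)"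
proof
  have ev: "\<forall>\<^sub>F t::real in at_top. 0 < t" by (rule eventually_gt_at_top)
  show "\<forall>\<^sub>F t in at_top. 0 < lam t * \<epsilon>\<^sup>2"
    using ev by eventually_elim (use \<epsilon> pos in simp)
  show "\<forall>\<^sub>F t in at_top. 0 < sig (lam t) \<epsilon> \<and> sig (lam t) \<epsilon> \<le> 1"
    by (simp add: sig_def sech_bounds)
  have "((\<lambda>t. lam t * \<epsilon>\<^sup>2) \<longlongrightarrow> 0 * \<epsilon>\<^sup>2) at_top" by (intro tendsto_intros lim)
  then show "((\<lambda>t. lam t * \<epsilon>\<^sup>2) \<longlongrightarrow> 0) at_top" by simp
  let ?y = "\<lambda>t. \<epsilon> * sqrt (2 * lam t)"
  have "(?y \<longlongrightarrow> \<epsilon> * sqrt (2 * 0)) at_top" by (intro tendsto_intros lim)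
  moreover have "\<forall>\<^sub>F t in at_top. 0 < ?y t"
    using ev by eventually_elim (use \<epsilon> pos in simp)
  ultimately have "filterlim ?y (at_right 0) at_top"
    by (auto simp: filterlim_at elim: eventually_mono)
  from filterlim_compose[OF sech_quadratic this]
  show "((\<lambda>t. (1 - sig (lam t) \<epsilon>) / (lam t * \<epsilon>\<^sup>2)) \<longlongrightarrow> 1) at_top"
  proof (rule Lim_transform_eventually)
    show "\<forall>\<^sub>F t in at_top. (1 - sech (?y t)) / ((?y t)\<^sup>2 / 2) = (1 - sig (lam t) \<epsilon>) / (lam t * \<epsilon>\<^sup>2)"
      using ev
    proof eventually_elim
      case (elim t)
      then have "(?y t)\<^sup>2 / 2 = lam t * \<epsilon>\<^sup>2"
        using pos[of t] by (simp add: power_mult_distrib)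
      then show ?case by (simp add: sig_def)
    qed
  qed
qed

text \<open>Clipping the labels at 0 is a measurable map into the waiting space and fixes the trees with
  nonnegative labels.\<close>

lemma sets_waiting_space:
  assumes A: "A \<in> sets waiting_space"
  shows "A \<in> sets tree_borel"
proof -
  let ?clip = "\<lambda>(x :: vertex \<Rightarrow> real) w. max 0 (x w)"
  have sp: "space waiting_space = {x. \<forall>w. 0 \<le> x w}"
    by (auto simp: waiting_space_def space_PiM space_restrict_space PiE_def Pi_def)
  have clip: "?clip \<in> measurable tree_borel waiting_space"
    unfolding waiting_space_def
  proof (rule measurable_PiM_single')
    fix w :: vertex
    have "(\<lambda>x. max 0 (x w)) \<in> borel_measurable tree_borel"
      using measurable_label[of w] by measurable
    then show "(\<lambda>x. max 0 (x w)) \<in> measurable tree_borel (restrict_space borel {0..})"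
      by (intro measurable_restrict_space2) auto
  qed (auto simp: space_restrict_space)
  have "A \<subseteq> {x. \<forall>w. 0 \<le> x w}" using sets.sets_into_space[OF A] by (simp add: sp)
  moreover have "?clip x = x" if "\<forall>w. 0 \<le> x w" for x using that by (auto simp: max_def)
  ultimately have "A = {x \<in> space tree_borel. \<forall>w. 0 \<le> x w} \<inter> (?clip -` A \<inter> space tree_borel)"
    by (auto simp: subset_iff)
  also have "\<dots> \<in> sets tree_borel"
  proof (rule sets.Int[OF _ measurable_sets[OF clip A]])
    note [measurable] = measurable_label
    show "{x \<in> space tree_borel. \<forall>w. 0 \<le> x w} \<in> sets tree_borel"
      by measurable
  qed
  finally show ?thesis .
qed

theorem theorem5p4:
  fixes M :: "'a measure" and e :: "vertex \<Rightarrow> 'a \<Rightarrow> real"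
    and N :: "'b measure" and S :: "'b \<Rightarrow> real" and e' :: "vertex \<Rightarrow> 'b \<Rightarrow> real"
    and \<epsilon> \<Delta> :: real and lam :: "real \<Rightarrow> real" and A0 A1 :: "(vertex \<Rightarrow> real) set"
  assumes "branching_tree M e"
    and "limiting_model N S e'"
    and "\<epsilon> > 0"
    and "\<And>t. t > 0 \<Longrightarrow> lam t > 0"
    and "(lam \<longlongrightarrow> 0) at_top"
    and "filterlim (\<lambda>t. t + ln (lam t * \<epsilon>\<^sup>2)) at_top at_top"
    and "A0 \<in> sets waiting_space" and "A1 \<in> sets waiting_space"
  shows "((\<lambda>t. P_hat M e \<epsilon> (lam t) t
            {\<omega> \<in> space M. e [] \<omega> \<le> \<Delta> + t + ln (lam t * \<epsilon>\<^sup>2) \<and>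
               (\<lambda>w. e (False # w) \<omega>) \<in> A0 \<and> (\<lambda>w. e (True # w) \<omega>) \<in> A1})
          \<longlongrightarrow> measure N
            {\<omega> \<in> space N. S \<omega> \<le> \<Delta> \<and>
               (\<lambda>w. e' (False # w) \<omega>) \<in> A0 \<and> (\<lambda>w. e' (True # w) \<omega>) \<in> A1}) at_top"
proof -
  interpret scaling "\<lambda>t. sig (lam t) \<epsilon>" "\<lambda>t. lam t * \<epsilon>\<^sup>2"
    by (rule scaling_sig[OF assms(3-5)])
  note A = sets_waiting_space[OF assms(7)] sets_waiting_space[OF assms(8)]
  show ?thesis
    unfolding limiting_model_split[OF assms(2) A]
  proof (rule Lim_transform_eventually[OF first_branching_converges[OF assms(6) A]])
    have "\<forall>\<^sub>F t::real in at_top. 0 \<le> t" by (rule eventually_ge_at_top)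
    then show "\<forall>\<^sub>F t in at_top. conditioned (sig (lam t) \<epsilon>) t (split_event {..\<Delta> + t + ln (lam t * \<epsilon>\<^sup>2)} A0 A1) =
        P_hat M e \<epsilon> (lam t) t
            {\<omega> \<in> space M. e [] \<omega> \<le> \<Delta> + t + ln (lam t * \<epsilon>\<^sup>2) \<and>
               (\<lambda>w. e (False # w) \<omega>) \<in> A0 \<and> (\<lambda>w. e (True # w) \<omega>) \<in> A1}"
    proof eventually_elim
      case (elim t)
      have "P_hat M e \<epsilon> (lam t) t {\<omega> \<in> space M. (\<lambda>w. e w \<omega>) \<in> split_event {..\<Delta> + t + ln (lam t * \<epsilon>\<^sup>2)} A0 A1} =
          conditioned (sig (lam t) \<epsilon>) t (split_event {..\<Delta> + t + ln (lam t * \<epsilon>\<^sup>2)} A0 A1)"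
        using elim A by (intro P_hat_eq_conditioned assms(1) sets_split_event)
          (simp_all add: sig_def sech_bounds)
      then show ?case by (simp add: split_event_def subtree_def)
    qed
  qed
qed

end
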